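(* There exist a nonempty metric space $X$ that is proper and of bounded geometry, and a function $c\colon[0,\infty)\to[0,\infty)$ such that $d_R(s,t)=c(|s-t|)$ defines a metric on $\mathbb{R}$ that is coarsely and topologically equivalent to the standard metric $|s-t|$, such that the metric space $R=(\mathbb{R},d_R)$ satisfies $\operatorname{asdim}_{AN}R=1$ and $$\operatorname{asdim}_{AN}(X\times R)=\operatorname{asdim}_{AN}X<\operatorname{asdim}_{AN}X+\operatorname{asdim}_{AN}R .$$
   Context: The product $X\times R$ of metric spaces $(X,d_X),(R,d_R)$ carries the metric $\max\{d_X(x,x'),d_R(s,s')\}$. Write $\mathbb{R}_+=[0,\infty)$. An $n$-dimensional control function for a metric space $X$ is any function $D_X\colon\mathbb{R}_+\to\mathbb{R}_+\cup\{\infty\}$ such that for every $r\in\mathbb{R}_+$ there is a cover $\mathcal U=\bigcup_{i=1}^{n+1}\mathcal U_i$ of $X$ such that each family $\mathcal U_i$ is $r$-disjoint (points lying in distinct members of $\mathcal U_i$ are at distance at least $r$) and the diameter of every element of $\mathcal U$ is at most $D_X(r)$. The asymptotic Assouad-Nagata dimension satisfies $\operatorname{asdim}_{AN}X\le n$ if $X$ has an affine $n$-dimensional control function ($r\mapsto Ar+B$ with real $A,B$); $\operatorname{asdim}_{AN}X$ is the least integer $n\ge0$ with $\operatorname{asdim}_{AN}X\le n$, and $\infty$ if there is none. Two metrics $d,d'$ on a set $Z$ are coarsely equivalent if there are nondecreasing unbounded functions $\phi,\Phi\colon[0,\infty)\to[0,\infty)$ with $\phi(d(x,y))\le d'(x,y)\le\Phi(d(x,y))$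 for all $x,y\in Z$; they are topologically equivalent if they induce the same topology. A metric space is proper if its closed balls are compact. It has bounded geometry if there is $\varepsilon>0$ such that for every $r>0$ there is $N_r\in\mathbb{N}$ such that every subset of a ball of radius $r$ whose distinct points are at distance at least $\varepsilon$ has at most $N_r$ elements. *)

theory Defs
  imports "HOL-Analysis.Analysis"
begin

text \<open>Metric spaces are given as a carrier set with a metric, as in the locale
  \<^locale>\<open>Metric_space\<close>.\<close>

definition max_metric ::
  "('a \<Rightarrow> 'a \<Rightarrow> real) \<Rightarrow> ('b \<Rightarrow> 'b \<Rightarrow> real) \<Rightarrow> 'a \<times> 'b \<Rightarrow> 'a \<times> 'b \<Rightarrow> real" where
  "max_metric d1 d2 = (\<lambda>(x, s) (x', s'). max (d1 x x') (d2 s s'))"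

text \<open>Suprema are taken in \<^typ>\<open>ennreal\<close>, so an unbounded set has diameter \<open>\<infinity>\<close>
  and the empty set has diameter \<open>0\<close>.\<close>

definition ediameter :: "('a \<Rightarrow> 'a \<Rightarrow> real) \<Rightarrow> 'a set \<Rightarrow> ennreal" where
  "ediameter d U = (SUP x\<in>U. SUP y\<in>U. ennreal (d x y))"

definition r_disjoint :: "('a \<Rightarrow> 'a \<Rightarrow> real) \<Rightarrow> real \<Rightarrow> 'a set set \<Rightarrow> bool" where
  "r_disjoint d r \<U> \<longleftrightarrow> (\<forall>U\<in>\<U>. \<forall>V\<in>\<U>. U \<noteq> V \<longrightarrow> (\<forall>x\<in>U. \<forall>y\<in>V. r \<le> d x y))"

text \<open>Only the values of \<open>D\<close> on \<open>[0,\<infinity>)\<close> matter.\<close>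

definition control_function ::
  "nat \<Rightarrow> 'a set \<Rightarrow> ('a \<Rightarrow> 'a \<Rightarrow> real) \<Rightarrow> (real \<Rightarrow> ennreal) \<Rightarrow> bool" where
  "control_function n M d D \<longleftrightarrow>
     (\<forall>r\<ge>0. \<exists>\<U> :: nat \<Rightarrow> 'a set set.
        (\<forall>i\<in>{1..n + 1}. \<U> i \<subseteq> Pow M) \<and>
        \<Union>(\<Union>i\<in>{1..n + 1}. \<U> i) = M \<and>
        (\<forall>i\<in>{1..n + 1}. r_disjoint d r (\<U> i)) \<and>
        (\<forall>U\<in>(\<Union>i\<in>{1..n + 1}. \<U> i). ediameter d U \<le> D r))"

text \<open>The nonnegativity condition makes \<open>r \<mapsto> A r + B\<close> a function from \<open>[0,\<infinity>)\<close> to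
  \<open>[0,\<infinity>)\<close>; without it \<^const>\<open>ennreal\<close> would truncate negative values to \<open>0\<close>.\<close>

definition asdim_AN_le :: "'a set \<Rightarrow> ('a \<Rightarrow> 'a \<Rightarrow> real) \<Rightarrow> nat \<Rightarrow> bool" where
  "asdim_AN_le M d n \<longleftrightarrow>
     (\<exists>A B :: real. (\<forall>r\<ge>0. 0 \<le> A * r + B) \<and> control_function n M d (\<lambda>r. ennreal (A * r + B)))"

text \<open>The infimum of the empty subset of \<^typ>\<open>enat\<close> is \<open>\<infinity>\<close>.\<close>

definition asdim_AN :: "'a set \<Rightarrow> ('a \<Rightarrow> 'a \<Rightarrow> real) \<Rightarrow> enat" where
  "asdim_AN M d = Inf {enat n | n. asdim_AN_le M d n}"

definition coarsely_equivalent ::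
  "'a set \<Rightarrow> ('a \<Rightarrow> 'a \<Rightarrow> real) \<Rightarrow> ('a \<Rightarrow> 'a \<Rightarrow> real) \<Rightarrow> bool" where
  "coarsely_equivalent Z d d' \<longleftrightarrow>
     (\<exists>\<phi> \<Phi> :: real \<Rightarrow> real.
        \<phi> \<in> {0..} \<rightarrow> {0..} \<and> mono_on {0..} \<phi> \<and> \<not> bdd_above (\<phi> ` {0..}) \<and>
        \<Phi> \<in> {0..} \<rightarrow> {0..} \<and> mono_on {0..} \<Phi> \<and> \<not> bdd_above (\<Phi> ` {0..}) \<and>
        (\<forall>x\<in>Z. \<forall>y\<in>Z. \<phi> (d x y) \<le> d' x y \<and> d' x y \<le> \<Phi> (d x y)))"

definition topologically_equivalent ::
  "'a set \<Rightarrow> ('a \<Rightarrow> 'a \<Rightarrow> real) \<Rightarrow> ('a \<Rightarrow> 'a \<Rightarrow> real) \<Rightarrow> bool" where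
  "topologically_equivalent Z d d' \<longleftrightarrow>
     Metric_space.mtopology Z d = Metric_space.mtopology Z d'"

definition proper_metric :: "'a set \<Rightarrow> ('a \<Rightarrow> 'a \<Rightarrow> real) \<Rightarrow> bool" where
  "proper_metric M d \<longleftrightarrow>
     (\<forall>x\<in>M. \<forall>r. compactin (Metric_space.mtopology M d) (Metric_space.mcball M d x r))"

definition bounded_geometry :: "'a set \<Rightarrow> ('a \<Rightarrow> 'a \<Rightarrow> real) \<Rightarrow> bool" where
  "bounded_geometry M d \<longleftrightarrow>
     (\<exists>\<epsilon>>0. \<forall>r>0. \<exists>N :: nat. \<forall>x\<in>M. \<forall>S \<subseteq> Metric_space.mball M d x r.
        (\<forall>a\<in>S. \<forall>b\<in>S. a \<noteq> b \<longrightarrow> \<epsilon> \<le> d a b) \<longrightarrow> finite S \<and> card S \<le> N)"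

end

theory Submission
  imports Defs
begin

text \<open>
  The space \<open>X\<close> has \<open>asdim_AN X = 2\<close>, and so has its product with the line. It is a disjoint union of
  finite spaces, each of which is a tower of finite graphs \<open>V\<^sub>0 \<rightarrow> V\<^sub>1 \<rightarrow> \<dots> \<rightarrow> V\<^sub>J\<close>
  that show how the space looks at increasing scales.

  Given \<open>V\<^sub>i\<^sub>+\<^sub>1\<close>, the graph \<open>V\<^sub>i\<close> is a space of paths in the 2-skeleton \<open>Q\<close> of the product of the
  clique complex of \<open>V\<^sub>i\<^sub>+\<^sub>1\<close> with \<open>[0, 1]\<close>; points are adjacent if their paths
  stay close to each other (and \<open>V\<^sub>i\<close> is then subdivided). Evaluation maps \<open>V\<^sub>i \<times> \<real>\<close> to a
  2-complex, and the cells of the complex, coloured by dimension, pull back to a cover of \<open>V\<^sub>i \<times> \<real>\<close> by three disjoint families. This is where it matters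
  that the line may be stretched: the paths take a very long time \<open>M\<close> from the bottom to the top.

  On the other hand a bounded integral 1-cocycle \<open>f\<close> on \<open>V\<^sub>i\<close> restricts to a 1-cocycle on \<open>V\<^sub>i\<^sub>+\<^sub>1\<close>.
  Indeed, the boundary of a triangle, regarded as a loop of paths, sweeps once over the boundary of
  a prism. In the time \<open>M\<close> there is room for \<open>K\<close> successive sweeps, which also form a short
  loop. It is homologous to \<open>K\<close> times the single sweep, so the value of \<open>f\<close> on the single sweep is a bounded number divided by \<open>K\<close>, hence \<open>0\<close>.
  Now a cover of \<open>X\<close> by two disjoint families gives a cocycle with values in
  \<open>{-1, 0, 1}\<close> on \<open>V\<^sub>0\<close> which does not restrict to a cocycle on a suitable \<open>V\<^sub>J\<close>.
\<close>

section \<open>Graphs and cocycles\<close>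

definition graph_on :: "'a set \<Rightarrow> ('a \<Rightarrow> 'a \<Rightarrow> bool) \<Rightarrow> bool" where
  "graph_on V G \<longleftrightarrow> finite V \<and> (\<forall>x\<in>V. G x x) \<and> (\<forall>x\<in>V. \<forall>y\<in>V. G x y \<longrightarrow> G y x)"

definition cocycle :: "'a set \<Rightarrow> ('a \<Rightarrow> 'a \<Rightarrow> bool) \<Rightarrow> ('a \<Rightarrow> 'a \<Rightarrow> int) \<Rightarrow> bool" where
  "cocycle V G f \<longleftrightarrow>
     (\<forall>x\<in>V. \<forall>y\<in>V. \<forall>z\<in>V. G x y \<and> G y z \<and> G x z \<longrightarrow> f x z = f x y + f y z)"

definition bounded_cochain ::
  "'a set \<Rightarrow> ('a \<Rightarrow> 'a \<Rightarrow> bool) \<Rightarrow> int \<Rightarrow> ('a \<Rightarrow> 'a \<Rightarrow> int) \<Rightarrow> bool" where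
  "bounded_cochain V G B f \<longleftrightarrow> (\<forall>x\<in>V. \<forall>y\<in>V. G x y \<longrightarrow> \<bar>f x y\<bar> \<le> B)"

definition clique :: "('a \<Rightarrow> 'a \<Rightarrow> bool) \<Rightarrow> 'a set \<Rightarrow> bool" where
  "clique G A \<longleftrightarrow> (\<forall>x\<in>A. \<forall>y\<in>A. G x y)"

lemma cocycleD:
  "cocycle V G f \<Longrightarrow> x \<in> V \<Longrightarrow> y \<in> V \<Longrightarrow> z \<in> V \<Longrightarrow> G x y \<Longrightarrow> G y z \<Longrightarrow> G x z \<Longrightarrow>
    f x z = f x y + f y z"
  unfolding cocycle_def by blast

lemma cocycle_refl:
  assumes "cocycle V G f" "x \<in> V" "G x x"
  shows "f x x = 0"
  using cocycleD[OF assms(1,2,2,2,3,3,3)] by simp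

lemma cocycle_sym:
  assumes "cocycle V G f" "x \<in> V" "y \<in> V" "G x x" "G x y" "G y x"
  shows "f y x = - f x y"
  using cocycleD[OF assms(1,2,3,2,5,6,4)] cocycle_refl[OF assms(1,2,4)] by simp

text \<open>This is how a cochain \<open>g\<close> that sums \<open>f\<close> along paths lying over single edges sees potentials
  of \<open>f\<close>.\<close>

definition sums_over_edges ::
  "'a set \<Rightarrow> ('a \<Rightarrow> 'a \<Rightarrow> bool) \<Rightarrow> 'b set \<Rightarrow> ('b \<Rightarrow> 'b \<Rightarrow> bool) \<Rightarrow> ('b \<Rightarrow> 'a) \<Rightarrow> ('a \<Rightarrow> 'b) \<Rightarrow>
    ('b \<Rightarrow> 'b \<Rightarrow> int) \<Rightarrow> ('a \<Rightarrow> 'a \<Rightarrow> int) \<Rightarrow> bool" where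
  "sums_over_edges V G V' G' \<pi> s f g \<longleftrightarrow>
     (\<forall>u\<in>V. \<forall>v\<in>V. \<forall>h. G u v \<longrightarrow>
        (\<forall>x\<in>V'. \<forall>y\<in>V'. \<pi> x \<in> {u, v} \<longrightarrow> \<pi> y \<in> {u, v} \<longrightarrow> G' x y \<longrightarrow> f x y = h y - h x) \<longrightarrow>
        g u v = h (s v) - h (s u))"

text \<open>The primed graph is the finer one. Its cocycles are restricted along the section
  \<open>s\<close>, which need not be a graph map: edges become paths. The bounds are part of the
  data because the restriction works only for cocycles with a bound known in advance.\<close>

definition graph_refines ::
  "'a set \<Rightarrow> ('a \<Rightarrow> 'a \<Rightarrow> bool) \<Rightarrow> int \<Rightarrow> 'b set \<Rightarrow> ('b \<Rightarrow> 'b \<Rightarrow> bool) \<Rightarrow> int \<Rightarrow>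
    ('b \<Rightarrow> 'a) \<Rightarrow> ('a \<Rightarrow> 'b) \<Rightarrow> bool" where
  "graph_refines V G B V' G' B' \<pi> s \<longleftrightarrow>
     (\<forall>x\<in>V'. \<pi> x \<in> V) \<and> (\<forall>v\<in>V. s v \<in> V' \<and> \<pi> (s v) = v) \<and>
     (\<forall>x\<in>V'. \<forall>y\<in>V'. G' x y \<longrightarrow> G (\<pi> x) (\<pi> y)) \<and>
     (\<forall>f. cocycle V' G' f \<longrightarrow> bounded_cochain V' G' B' f \<longrightarrow>
        (\<exists>g. cocycle V G g \<and> bounded_cochain V G B g \<and> sums_over_edges V G V' G' \<pi> s f g))"

lemma sums_over_edgesI:
  assumes "\<And>u v h. u \<in> V \<Longrightarrow> v \<in> V \<Longrightarrow> G u v \<Longrightarrow>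
    (\<And>x y. x \<in> V' \<Longrightarrow> y \<in> V' \<Longrightarrow> \<pi> x \<in> {u, v} \<Longrightarrow> \<pi> y \<in> {u, v} \<Longrightarrow> G' x y \<Longrightarrow> f x y = h y - h x) \<Longrightarrow>
    g u v = h (s v) - h (s u)"
  shows "sums_over_edges V G V' G' \<pi> s f g"
  unfolding sums_over_edges_def by (intro ballI allI impI assms) auto

lemma sums_over_edgesD:
  assumes "sums_over_edges V G V' G' \<pi> s f g" "u \<in> V" "v \<in> V" "G u v"
    "\<And>x y. x \<in> V' \<Longrightarrow> y \<in> V' \<Longrightarrow> \<pi> x \<in> {u, v} \<Longrightarrow> \<pi> y \<in> {u, v} \<Longrightarrow> G' x y \<Longrightarrow> f x y = h y - h x"
  shows "g u v = h (s v) - h (s u)"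
  using assms(1)[unfolded sums_over_edges_def, rule_format, OF assms(2-4), of h] assms(5) by metis

lemma graph_refinesI:
  assumes "\<And>x. x \<in> V' \<Longrightarrow> \<pi> x \<in> V" "\<And>v. v \<in> V \<Longrightarrow> s v \<in> V'" "\<And>v. v \<in> V \<Longrightarrow> \<pi> (s v) = v"
    "\<And>x y. x \<in> V' \<Longrightarrow> y \<in> V' \<Longrightarrow> G' x y \<Longrightarrow> G (\<pi> x) (\<pi> y)"
    "\<And>f. cocycle V' G' f \<Longrightarrow> bounded_cochain V' G' B' f \<Longrightarrow>
       \<exists>g. cocycle V G g \<and> bounded_cochain V G B g \<and> sums_over_edges V G V' G' \<pi> s f g"
  shows "graph_refines V G B V' G' B' \<pi> s"
  unfolding graph_refines_def using assms by simp

lemma graph_refinesD: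
  assumes "graph_refines V G B V' G' B' \<pi> s"
  shows "x \<in> V' \<Longrightarrow> \<pi> x \<in> V" "v \<in> V \<Longrightarrow> s v \<in> V'" "v \<in> V \<Longrightarrow> \<pi> (s v) = v"
    "x \<in> V' \<Longrightarrow> y \<in> V' \<Longrightarrow> G' x y \<Longrightarrow> G (\<pi> x) (\<pi> y)"
    "cocycle V' G' f \<Longrightarrow> bounded_cochain V' G' B' f \<Longrightarrow>
       \<exists>g. cocycle V G g \<and> bounded_cochain V G B g \<and> sums_over_edges V G V' G' \<pi> s f g"
  using assms unfolding graph_refines_def by simp_all

lemma graph_refines_id: "graph_refines V G B V G B id id"
  by (intro graph_refinesI) (auto simp: sums_over_edges_def)

text \<open>A potential \<open>h\<close> of \<open>f\<close> over an edge yields the potential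
  \<open>h \<circ> s'\<close> of \<open>g\<close> over the same edge, by the first hypothesis
  applied to each finer edge above it.\<close>

lemma sums_over_edges_trans:
  assumes fg: "sums_over_edges V' G' V'' G'' \<pi>' s' f g" and gk: "sums_over_edges V G V' G' \<pi> s g k"
  shows "sums_over_edges V G V'' G'' (\<pi> \<circ> \<pi>') (s' \<circ> s) f k"
proof (rule sums_over_edgesI)
  fix u v h assume uv: "u \<in> V" "v \<in> V" "G u v"
    and h: "\<And>x y. x \<in> V'' \<Longrightarrow> y \<in> V'' \<Longrightarrow> (\<pi> \<circ> \<pi>') x \<in> {u, v} \<Longrightarrow> (\<pi> \<circ> \<pi>') y \<in> {u, v} \<Longrightarrow> G'' x y \<Longrightarrow>
      f x y = h y - h x"
  have "k u v = (h \<circ> s') (s v) - (h \<circ> s') (s u)"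
  proof (rule sums_over_edgesD[OF gk uv])
    fix x y assume xy: "x \<in> V'" "y \<in> V'" "\<pi> x \<in> {u, v}" "\<pi> y \<in> {u, v}" "G' x y"
    have "g x y = h (s' y) - h (s' x)"
    proof (rule sums_over_edgesD[OF fg xy(1,2,5)])
      fix a b assume "a \<in> V''" "b \<in> V''" "\<pi>' a \<in> {x, y}" "\<pi>' b \<in> {x, y}" "G'' a b"
      then show "f a b = h b - h a" using xy(3,4) by (intro h) auto
    qed
    then show "g x y = (h \<circ> s') y - (h \<circ> s') x" by simp
  qed
  then show "k u v = h ((s' \<circ> s) v) - h ((s' \<circ> s) u)" by simp
qed

lemma graph_refines_trans:
  assumes 1: "graph_refines V G B V' G' B' \<pi> s" and 2: "graph_refines V' G' B' V'' G'' B'' \<pi>' s'"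
  shows "graph_refines V G B V'' G'' B'' (\<pi> \<circ> \<pi>') (s' \<circ> s)"
proof (rule graph_refinesI)
  fix f assume f: "cocycle V'' G'' f" "bounded_cochain V'' G'' B'' f"
  obtain g where g: "cocycle V' G' g" "bounded_cochain V' G' B' g"
      "sums_over_edges V' G' V'' G'' \<pi>' s' f g"
    using graph_refinesD(5)[OF 2 f] by blast
  obtain k where "cocycle V G k" "bounded_cochain V G B k" "sums_over_edges V G V' G' \<pi> s g k"
    using graph_refinesD(5)[OF 1 g(1,2)] by blast
  then show "\<exists>k. cocycle V G k \<and> bounded_cochain V G B k \<and>
      sums_over_edges V G V'' G'' (\<pi> \<circ> \<pi>') (s' \<circ> s) f k"
    using sums_over_edges_trans[OF g(3)] by blast
qed (use graph_refinesD(1-4)[OF 1] graph_refinesD(1-4)[OF 2] in simp_all)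

text \<open>Each refinement passes to vertices of a more complicated type. Renaming them by natural
  numbers keeps the type fixed, so that refinements can be iterated.\<close>

lemma graph_refines_relabel:
  assumes "finite V"
  obtains W :: "nat set" and r e where "inj_on e V" "W = e ` V" "r = the_inv_into V e"
    "\<And>B. graph_refines V G B W (\<lambda>x y. G (r x) (r y)) B r e"
proof -
  obtain e :: "'a \<Rightarrow> nat" where e: "inj_on e V"
    using finite_imp_inj_to_nat_seg[OF assms] by blast
  define r where "r = the_inv_into V e"
  have r[simp]: "r (e x) = x" if "x \<in> V" for x
    using that e by (simp add: r_def the_inv_into_f_f)
  have "graph_refines V G B (e ` V) (\<lambda>x y. G (r x) (r y)) B r e" for B
  proof (rule graph_refinesI)
    fix f assume f: "cocycle (e ` V) (\<lambda>x y. G (r x) (r y)) f"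
        "bounded_cochain (e ` V) (\<lambda>x y. G (r x) (r y)) B f"
    have "sums_over_edges V G (e ` V) (\<lambda>x y. G (r x) (r y)) r e f (\<lambda>x y. f (e x) (e y))"
      by (rule sums_over_edgesI) simp
    with f show "\<exists>g. cocycle V G g \<and> bounded_cochain V G B g \<and>
        sums_over_edges V G (e ` V) (\<lambda>x y. G (r x) (r y)) r e f g"
      by (intro exI[of _ "\<lambda>x y. f (e x) (e y)"]) (auto simp: cocycle_def bounded_cochain_def)
  qed auto
  with e r_def that show thesis by blast
qed

section \<open>Subdivision\<close>

text \<open>A pair \<open>(A, C)\<close> is an interval in the face poset of the clique complex, and
  \<open>nested\<close> is inclusion of intervals one way or the other. Simplices alone, ordered by
  inclusion, would not do: two simplices with a common face need not lie in a common clique.\<close>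

definition intervals :: "'a set \<Rightarrow> ('a \<Rightarrow> 'a \<Rightarrow> bool) \<Rightarrow> ('a set \<times> 'a set) set" where
  "intervals V G = {(A, C). A \<noteq> {} \<and> A \<subseteq> C \<and> C \<subseteq> V \<and> clique G C}"

definition nested :: "'a set \<times> 'a set \<Rightarrow> 'a set \<times> 'a set \<Rightarrow> bool" where
  "nested I J \<longleftrightarrow> fst I \<subseteq> fst J \<and> snd J \<subseteq> snd I \<or> fst J \<subseteq> fst I \<and> snd I \<subseteq> snd J"

definition pick :: "'a set \<Rightarrow> 'a" where
  "pick A = (SOME x. x \<in> A)"

lemma pick_in: "A \<noteq> {} \<Longrightarrow> pick A \<in> A"
  unfolding pick_def by (rule someI_ex) blast

lemma pick_singleton[simp]: "pick {x} = x"
  unfolding pick_def by simp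

lemma graph_on_intervals: "graph_on V G \<Longrightarrow> graph_on (intervals V G) nested"
proof -
  assume "graph_on V G"
  then have "finite V" by (simp add: graph_on_def)
  moreover have "intervals V G \<subseteq> Pow V \<times> Pow V" by (auto simp: intervals_def)
  ultimately have "finite (intervals V G)" by (meson finite_Pow_iff finite_SigmaI finite_subset)
  then show ?thesis unfolding graph_on_def nested_def by auto
qed

text \<open>In each of the four orders of inclusion, the lower ends of the outer two intervals lie
  in the upper end of one of the three, which is a clique.\<close>

lemma nested_contracts:
  assumes "I \<in> intervals V G" "J \<in> intervals V G" "K \<in> intervals V G" "nested I J" "nested J K"
  shows "G (pick (fst I)) (pick (fst K))"
proof -
  obtain A C A' C' A'' C'' where IJK: "I = (A, C)" "J = (A', C')" "K = (A'', C'')"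
    by (metis prod.collapse)
  have p: "pick A \<in> A" "pick A'' \<in> A''" using assms IJK by (auto simp: intervals_def pick_in)
  obtain S where "clique G S" "A \<subseteq> S" "A'' \<subseteq> S"
  proof -
    have "A \<subseteq> C \<and> A'' \<subseteq> C \<or> A \<subseteq> C' \<and> A'' \<subseteq> C' \<or> A \<subseteq> C'' \<and> A'' \<subseteq> C''"
      using assms unfolding IJK intervals_def nested_def by auto
    then show thesis using that assms unfolding IJK intervals_def by auto
  qed
  with p show ?thesis unfolding IJK clique_def by auto
qed

text \<open>An edge becomes a path of four edges through its simplex, hence the factor 4. The
  cocycle relation on a triangle holds because the intervals below it can be coned off.\<close>

lemma graph_refines_intervals:
  assumes G: "graph_on V G"
  shows "graph_refines V G (4 * B) (intervals V G) nested B (pick \<circ> fst) (\<lambda>v. ({v}, {v}))"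
proof (rule graph_refinesI)
  fix x assume "x \<in> intervals V G" then show "(pick \<circ> fst) x \<in> V"
    using pick_in[of "fst x"] unfolding intervals_def by (cases x) auto
next
  fix v assume "v \<in> V" then show "({v}, {v}) \<in> intervals V G"
    using G by (auto simp: intervals_def graph_on_def clique_def)
next
  fix v :: 'a show "(pick \<circ> fst) ({v}, {v}) = v" by simp
next
  fix x y assume "x \<in> intervals V G" "y \<in> intervals V G" "nested x y"
  then show "G ((pick \<circ> fst) x) ((pick \<circ> fst) y)"
    using nested_contracts[of x V G y y] by (auto simp: nested_def)
next
  fix f assume f: "cocycle (intervals V G) nested f" "bounded_cochain (intervals V G) nested B f"
  define g where "g u v = f ({u}, {u}) ({u}, {u, v}) + f ({u}, {u, v}) ({u, v}, {u, v})
     + f ({u, v}, {u, v}) ({v}, {u, v}) + f ({v}, {u, v}) ({v}, {v})" for u v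
  have mem: "({u}, {u}) \<in> intervals V G" "({u}, {u, v}) \<in> intervals V G"
    "({u, v}, {u, v}) \<in> intervals V G" "({v}, {u, v}) \<in> intervals V G" "({v}, {v}) \<in> intervals V G"
    if "u \<in> V" "v \<in> V" "G u v" for u v
    using that G by (auto simp: intervals_def clique_def graph_on_def)
  have nes: "nested ({u}, {u}) ({u}, {u, v})" "nested ({u}, {u, v}) ({u, v}, {u, v})"
    "nested ({u, v}, {u, v}) ({v}, {u, v})" "nested ({v}, {u, v}) ({v}, {v})" for u v :: 'a
    by (auto simp: nested_def)
  have coc: "cocycle V G g"
    unfolding cocycle_def
  proof (intro ballI impI)
    fix x y z assume V: "x \<in> V" "y \<in> V" "z \<in> V" and E: "G x y \<and> G y z \<and> G x z"
    define S where "S = {x, y, z}"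
    define H where "H I = f I (fst I, S) + f (fst I, S) (S, S)" for I
    have S: "clique G S" "S \<subseteq> V" "S \<noteq> {}" using V E G by (auto simp: S_def clique_def graph_on_def)
    \<comment> \<open>the cone with apex \<open>(S, S)\<close> makes \<open>f\<close> a coboundary on the intervals below \<open>S\<close>\<close>
    have cone: "f I J = H I - H J" if "I \<in> intervals V G" "J \<in> intervals V G" "snd I \<subseteq> S" "snd J \<subseteq> S"
      and n: "fst J \<subseteq> fst I" "snd I \<subseteq> snd J" for I J
    proof -
      obtain A C A' C' where IJ: "I = (A, C)" "J = (A', C')" by (metis prod.collapse)
      have m: "(A, S) \<in> intervals V G" "(A', S) \<in> intervals V G" "(S, S) \<in> intervals V G"
        using that S by (auto simp: IJ intervals_def)
      have sub: "A' \<subseteq> A" "A \<subseteq> S" "A' \<subseteq> S" "C \<subseteq> C'" "C \<subseteq> S" "C' \<subseteq> S"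
        using that by (auto simp: IJ intervals_def)
      have "f I (A', S) = f I J + f J (A', S)"
        by (rule cocycleD[OF f(1)]) (use that m sub in \<open>auto simp: IJ nested_def\<close>)
      moreover have "f I (A', S) = f I (A, S) + f (A, S) (A', S)"
        by (rule cocycleD[OF f(1)]) (use that m sub in \<open>auto simp: IJ nested_def\<close>)
      moreover have "f (A, S) (S, S) = f (A, S) (A', S) + f (A', S) (S, S)"
        by (rule cocycleD[OF f(1)]) (use that m sub in \<open>auto simp: IJ nested_def\<close>)
      ultimately show ?thesis by (simp add: H_def IJ)
    qed
    have cone': "f I J = H I - H J" if "I \<in> intervals V G" "J \<in> intervals V G" "snd I \<subseteq> S" "snd J \<subseteq> S"
      and n: "nested I J" for I J
    proof (cases "fst J \<subseteq> fst I \<and> snd I \<subseteq> snd J")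
      case True
      then show ?thesis using that by (intro cone) simp_all
    next
      case False
      then have "f J I = H J - H I" using that by (intro cone) (auto simp: nested_def)
      moreover have "f J I = - f I J"
        by (rule cocycle_sym[OF f(1)]) (use that in \<open>auto simp: nested_def\<close>)
      ultimately show ?thesis by simp
    qed
    have "g u v = H ({u}, {u}) - H ({v}, {v})" if "u \<in> S" "v \<in> S" for u v
    proof -
      have uv: "u \<in> V" "v \<in> V" "G u v" using that S by (auto simp: clique_def)
      show ?thesis unfolding g_def
        using cone'[OF mem(1,2)[OF uv] _ _ nes(1)] cone'[OF mem(2,3)[OF uv] _ _ nes(2)]
          cone'[OF mem(3,4)[OF uv] _ _ nes(3)] cone'[OF mem(4,5)[OF uv] _ _ nes(4)] that by simp
    qed
    then show "g x z = g x y + g y z" by (simp add: S_def)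
  qed
  have "bounded_cochain V G (4 * B) g"
    unfolding bounded_cochain_def
  proof (intro ballI impI)
    fix u v assume uv: "u \<in> V" "v \<in> V" "G u v"
    have *: "\<bar>f I J\<bar> \<le> B" if "I \<in> intervals V G" "J \<in> intervals V G" "nested I J" for I J
      using f that by (auto simp: bounded_cochain_def)
    show "\<bar>g u v\<bar> \<le> 4 * B"
      using *[OF mem(1,2)[OF uv] nes(1)] *[OF mem(2,3)[OF uv] nes(2)]
        *[OF mem(3,4)[OF uv] nes(3)] *[OF mem(4,5)[OF uv] nes(4)] unfolding g_def by linarith
  qed
  moreover have "sums_over_edges V G (intervals V G) nested (pick \<circ> fst) (\<lambda>v. ({v}, {v})) f g"
  proof (rule sums_over_edgesI)
    fix u v h assume uv: "u \<in> V" "v \<in> V" "G u v"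
      and h: "\<And>x y. x \<in> intervals V G \<Longrightarrow> y \<in> intervals V G \<Longrightarrow>
      (pick \<circ> fst) x \<in> {u, v} \<Longrightarrow> (pick \<circ> fst) y \<in> {u, v} \<Longrightarrow> nested x y \<Longrightarrow> f x y = h y - h x"
    \<comment> \<open>Whichever end \<open>pick\<close> chooses, the whole path of four edges lies
      over \<open>u\<close> and \<open>v\<close>, so \<open>h\<close> telescopes along it.\<close>
    have "pick {u, v} \<in> {u, v}" by (rule pick_in) simp
    then show "g u v = h ({v}, {v}) - h ({u}, {u})"
      using h[OF mem(1,2)[OF uv] _ _ nes(1)] h[OF mem(2,3)[OF uv] _ _ nes(2)]
        h[OF mem(3,4)[OF uv] _ _ nes(3)] h[OF mem(4,5)[OF uv] _ _ nes(4)]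
      unfolding g_def by simp
  qed
  ultimately show "\<exists>g. cocycle V G g \<and> bounded_cochain V G (4 * B) g \<and>
      sums_over_edges V G (intervals V G) nested (pick \<circ> fst) (\<lambda>v. ({v}, {v})) f g"
    using coc by blast
qed

section \<open>Trajectories\<close>

abbreviation near :: "nat \<Rightarrow> nat \<Rightarrow> bool" where
  "near a b \<equiv> a \<le> Suc b \<and> b \<le> Suc a"

text \<open>One cell is a face of the other; \<open>2\<close> is the interval with ends
  \<open>0\<close> and \<open>1\<close>.\<close>

definition comparable :: "'a set \<times> nat \<Rightarrow> 'a set \<times> nat \<Rightarrow> bool" where
  "comparable p q \<longleftrightarrow>
     fst p \<subseteq> fst q \<and> (snd p = snd q \<or> snd q = 2) \<or> fst q \<subseteq> fst p \<and> (snd p = snd q \<or> snd p = 2)"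

text \<open>A pair \<open>(A, i)\<close> stands for the product of the simplex \<open>A\<close> with the vertex \<open>0\<close>, the vertex \<open>1\<close> or,
  for \<open>i = 2\<close>, the whole of the interval \<open>[0, 1]\<close>; only products of dimension at most \<open>2\<close> are cells.
  A trajectory is a path in this 2-complex from the bottom to the top.\<close>

definition cells :: "'a set \<Rightarrow> ('a \<Rightarrow> 'a \<Rightarrow> bool) \<Rightarrow> ('a set \<times> nat) set" where
  "cells V G = {(A, i). A \<noteq> {} \<and> A \<subseteq> V \<and> clique G A \<and> card A \<le> 3 \<and> i \<le> 2 \<and> (i = 2 \<longrightarrow> card A \<le> 2)}"

text \<open>The dimension plus one, so its values on \<open>cells\<close> are 1, 2 and 3.\<close>

definition cell_dim :: "'a set \<times> nat \<Rightarrow> nat" where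
  "cell_dim p = card (fst p) + (if snd p = 2 then 1 else 0)"

text \<open>Times may differ by one because in the product with the line both coordinates may move
  at once. In particular \<open>fellow \<omega> \<omega>\<close> makes \<open>\<omega>\<close> a
  path of incident cells.\<close>

definition fellow :: "(nat \<Rightarrow> 'a set \<times> nat) \<Rightarrow> (nat \<Rightarrow> 'a set \<times> nat) \<Rightarrow> bool" where
  "fellow \<omega> \<eta> \<longleftrightarrow> (\<forall>s t. near s t \<longrightarrow> comparable (\<omega> s) (\<eta> t))"

text \<open>The clique \<open>S\<close> confines each path to a bounded region, which later bounds
  the pieces of the cover. Being constant from \<open>M\<close> on makes the set finite for finite
  \<open>V\<close>.\<close>

definition trajectories :: "'a set \<Rightarrow> ('a \<Rightarrow> 'a \<Rightarrow> bool) \<Rightarrow> nat \<Rightarrow> (nat \<Rightarrow> 'a set \<times> nat) set" where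
  "trajectories V G M = {\<omega>. (\<forall>t. \<omega> t \<in> cells V G) \<and> (\<forall>t\<ge>M. \<omega> t = \<omega> M) \<and> fellow \<omega> \<omega> \<and>
     snd (\<omega> 0) = 0 \<and> snd (\<omega> M) = 1 \<and> (\<exists>S. clique G S \<and> (\<forall>t. fst (\<omega> t) \<subseteq> S))}"

lemma comparable_sym: "comparable p q \<Longrightarrow> comparable q p"
  unfolding comparable_def by auto

lemma fellow_sym: "fellow \<omega> \<eta> \<Longrightarrow> fellow \<eta> \<omega>"
  unfolding fellow_def using comparable_sym by blast

text \<open>A proper face has smaller dimension. This is why colouring the cells by dimension gives
  disjoint families.\<close>

lemma comparable_same_dim:
  assumes "p \<in> cells V G" "q \<in> cells V G" "comparable p q" "cell_dim p = cell_dim q" "finite V"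
  shows "p = q"
proof -
  obtain A i A' j where pq: "p = (A, i)" "q = (A', j)" by (metis prod.collapse)
  have fin: "finite A" "finite A'" using assms pq by (auto simp: cells_def dest: finite_subset)
  have "A \<subseteq> A' \<Longrightarrow> card A = card A' \<Longrightarrow> A = A'" "A' \<subseteq> A \<Longrightarrow> card A = card A' \<Longrightarrow> A = A'"
    "A \<subseteq> A' \<Longrightarrow> card A \<le> card A'" "A' \<subseteq> A \<Longrightarrow> card A' \<le> card A"
    using fin card_subset_eq[of A' A] card_subset_eq[of A A'] by (simp_all add: card_mono)
  then show ?thesis using assms(3,4) unfolding pq comparable_def cell_dim_def
    by (auto split: if_splits)
qed

lemma graph_on_trajectories:
  assumes "finite V"
  shows "graph_on (trajectories V G M) fellow"
proof -
  have "finite (cells V G)"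
    by (rule finite_subset[of _ "Pow V \<times> {..2}"]) (use assms in \<open>auto simp: cells_def\<close>)
  then have fin: "finite (PiE {..M} (\<lambda>_. cells V G))" by (intro finite_PiE) auto
  have "trajectories V G M \<subseteq> (\<lambda>g t. g (min t M)) ` PiE {..M} (\<lambda>_. cells V G)"
  proof
    fix \<omega> assume \<omega>: "\<omega> \<in> trajectories V G M"
    have const: "\<omega> t = \<omega> M" if "M \<le> t" for t using \<omega> that unfolding trajectories_def by blast
    have "\<omega> t = restrict \<omega> {..M} (min t M)" for t
    proof (cases "t \<le> M")
      case False
      then show ?thesis using const[of t] by (simp add: min_def)
    qed (simp add: min_def)
    then have "\<omega> = (\<lambda>t. restrict \<omega> {..M} (min t M))" by (rule ext)
    moreover have "restrict \<omega> {..M} \<in> PiE {..M} (\<lambda>_. cells V G)"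
      using \<omega> unfolding trajectories_def restrict_PiE_iff by blast
    ultimately show "\<omega> \<in> (\<lambda>g t. g (min t M)) ` PiE {..M} (\<lambda>_. cells V G)" by blast
  qed
  then have "finite (trajectories V G M)" using fin finite_surj by blast
  then show ?thesis unfolding graph_on_def using fellow_sym unfolding trajectories_def by blast
qed

section \<open>Sums of a cocycle over closed loops of length six\<close>

text \<open>The strip between the two paths is cut by the diagonals from \<open>x j\<close> to
  \<open>y (Suc j)\<close> into triangles, on each of which the cocycle relation holds.\<close>

lemma ladder:
  assumes f: "cocycle V G f"
    and x: "\<And>j. j \<le> m \<Longrightarrow> x j \<in> V" and y: "\<And>j. j \<le> m \<Longrightarrow> y j \<in> V"
    and xx: "\<And>j. j < m \<Longrightarrow> G (x j) (x (Suc j))" and yy: "\<And>j. j < m \<Longrightarrow> G (y j) (y (Suc j))"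
    and xy: "\<And>j. j \<le> m \<Longrightarrow> G (x j) (y j)" and xy': "\<And>j. j < m \<Longrightarrow> G (x j) (y (Suc j))"
  shows "(\<Sum>j<m. f (x j) (x (Suc j))) + f (x m) (y m) = f (x 0) (y 0) + (\<Sum>j<m. f (y j) (y (Suc j)))"
  using x y xx yy xy xy'
proof (induction m)
  case (Suc m)
  have "f (x m) (y (Suc m)) = f (x m) (x (Suc m)) + f (x (Suc m)) (y (Suc m))"
    by (rule cocycleD[OF f]) (use Suc.prems in auto)
  moreover have "f (x m) (y (Suc m)) = f (x m) (y m) + f (y m) (y (Suc m))"
    by (rule cocycleD[OF f]) (use Suc.prems in auto)
  ultimately show ?case using Suc by simp
qed simp

definition loop_sum :: "('a \<Rightarrow> 'a \<Rightarrow> int) \<Rightarrow> (nat \<Rightarrow> 'a) \<Rightarrow> int" where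
  "loop_sum f x = (\<Sum>i<6. f (x i) (x (Suc i)))"

text \<open>The first and the last rung of the ladder coincide, so their contributions
  cancel.\<close>

lemma loop_sum_homotopy:
  assumes f: "cocycle V G f"
    and V: "\<And>i. i \<le> 6 \<Longrightarrow> x i \<in> V \<and> y i \<in> V"
    and G: "\<And>i j. i \<le> 6 \<Longrightarrow> j \<le> 6 \<Longrightarrow> near i j \<Longrightarrow> G (x i) (x j) \<and> G (y i) (y j) \<and> G (x i) (y j)"
    and p: "x 6 = x 0" "y 6 = y 0"
  shows "loop_sum f x = loop_sum f y"
  using ladder[OF f, of 6 x y] V G p unfolding loop_sum_def by simp

text \<open>The diagonal of a torus is homotopic to the horizontal loop followed by the vertical
  one. The induction pushes the diagonal up to step \<open>n\<close> onto the lower side followed by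
  column \<open>n\<close>; periodicity identifies column 6 with column 0.\<close>

lemma loop_sum_torus:
  assumes f: "cocycle V G f"
    and V: "\<And>i j. i \<le> 6 \<Longrightarrow> j \<le> 6 \<Longrightarrow> x i j \<in> V"
    and G: "\<And>i j k l. i \<le> 6 \<Longrightarrow> j \<le> 6 \<Longrightarrow> k \<le> 6 \<Longrightarrow> l \<le> 6 \<Longrightarrow> near i k \<Longrightarrow> near j l \<Longrightarrow> G (x i j) (x k l)"
    and p: "x 6 = x 0"
  shows "loop_sum f (\<lambda>i. x i i) = loop_sum f (\<lambda>i. x i 0) + loop_sum f (x 0)"
proof -
  have "(\<Sum>i<n. f (x i i) (x (Suc i) (Suc i))) =
      (\<Sum>i<n. f (x i 0) (x (Suc i) 0)) + (\<Sum>j<n. f (x n j) (x n (Suc j)))" if "n \<le> 6" for n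
    using that
  proof (induction n)
    case (Suc n)
    have "f (x n n) (x (Suc n) (Suc n)) = f (x n n) (x (Suc n) n) + f (x (Suc n) n) (x (Suc n) (Suc n))"
      by (rule cocycleD[OF f]) (use Suc.prems V G in auto)
    moreover have "(\<Sum>j<n. f (x n j) (x n (Suc j))) + f (x n n) (x (Suc n) n)
        = f (x n 0) (x (Suc n) 0) + (\<Sum>j<n. f (x (Suc n) j) (x (Suc n) (Suc j)))"
      by (rule ladder[OF f]) (use Suc.prems V G in auto)
    ultimately show ?case using Suc by simp
  qed simp
  from this[of 6] p show ?thesis unfolding loop_sum_def by simp
qed

section \<open>The boundary of a prism and paths over it\<close>

text \<open>A meridian of the prism as a function of the height from 0 to 6. For an edge
  (\<open>b\<close> true) the vertical cell lasts from 2 to 4, for a vertex only at 3. So between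
  the ends the cell over a vertex stays a face of the cell over an incident edge even if the heights
  differ by one.\<close>

definition profile :: "'a set \<Rightarrow> bool \<Rightarrow> 'a set \<Rightarrow> nat \<Rightarrow> 'a set \<times> nat" where
  "profile E b A a =
     (if a = 0 then (E, 0) else if a = 1 \<or> a = 2 \<and> \<not> b then (A, 0)
      else if a \<le> 3 \<or> a = 4 \<and> b then (A, 2) else if a \<le> 5 then (A, 1) else (E, 1))"

lemma profile_simps:
  "profile E b A 0 = (E, 0)" "profile E b A 1 = (A, 0)"
  "profile E b A 2 = (if b then (A, 2) else (A, 0))" "profile E b A 3 = (A, 2)"
  "profile E b A 4 = (if b then (A, 2) else (A, 1))" "profile E b A 5 = (A, 1)"
  "profile E b A 6 = (E, 1)"
  by (auto simp: profile_def)

lemma upto_6_cases: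
  fixes a :: nat
  obtains "6 < a" | "a = 0" | "a = 1" | "a = 2" | "a = 3" | "a = 4" | "a = 5" | "a = 6"
  by linarith

lemma comparable_profile:
  assumes "a \<le> 6" "a' \<le> 6" "near a a'"
    and sub: "E \<subseteq> E' \<or> E' \<subseteq> E" "A \<subseteq> E' \<or> E' \<subseteq> A" "E \<subseteq> A' \<or> A' \<subseteq> E"
    and A: "b = b' \<Longrightarrow> A = A'" "\<not> b \<Longrightarrow> b' \<Longrightarrow> A \<subseteq> A'" "b \<Longrightarrow> \<not> b' \<Longrightarrow> A' \<subseteq> A"
  shows "comparable (profile E b A a) (profile E' b' A' a')"
proof -
  consider "a' = a" | "a' = Suc a" | "a = Suc a'" using assms(3) by linarith
  then show ?thesis
  proof cases
    case 1
    show ?thesis using assms(1,2) sub A unfolding 1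
      by (cases b; cases b'; cases a rule: upto_6_cases) (simp_all add: profile_def comparable_def)
  next
    case 2
    show ?thesis using assms(1,2) sub A unfolding 2
      by (cases b; cases b'; cases a rule: upto_6_cases) (simp_all add: profile_def comparable_def)
  next
    case 3
    show ?thesis using assms(1,2) sub A unfolding 3
      by (cases b; cases b'; cases a' rule: upto_6_cases) (simp_all add: profile_def comparable_def)
  qed
qed

text \<open>The barycentrically subdivided boundary of the triangle: vertices at even positions,
  edges at odd ones, and position 6 is position 0 again.\<close>

definition hexagon :: "'a \<Rightarrow> 'a \<Rightarrow> 'a \<Rightarrow> nat \<Rightarrow> 'a set" where
  "hexagon u v w i = [{u}, {u, v}, {v}, {v, w}, {w}, {w, u}, {u}] ! i"

lemma hexagon_simps:
  "hexagon u v w 0 = {u}" "hexagon u v w 1 = {u, v}" "hexagon u v w (Suc 0) = {u, v}" "hexagon u v w 2 = {v}"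
  "hexagon u v w 3 = {v, w}" "hexagon u v w 4 = {w}" "hexagon u v w 5 = {w, u}"
  "hexagon u v w 6 = {u}"
  by (simp_all add: hexagon_def)

lemma hexagon_mono:
  assumes "i \<le> 6" "j \<le> 6" "near i j" "even i" "odd j"
  shows "hexagon u v w i \<subseteq> hexagon u v w j"
proof -
  have "i = Suc j \<or> Suc i = j"
    using assms(3-5) by (metis le_SucE le_antisym)
  then show ?thesis
  proof
    assume "i = Suc j"
    then show ?thesis using assms(1,2,5) by (cases j rule: upto_6_cases) (auto simp: hexagon_def)
  next
    assume "Suc i = j"
    then show ?thesis using assms(1,2,4) by (cases i rule: upto_6_cases) (auto simp: hexagon_def)
  qed
qed

lemma hexagon_sub: "i \<le> 6 \<Longrightarrow> hexagon u v w i \<subseteq> {u, v, w}"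
  by (cases i rule: upto_6_cases) (auto simp: hexagon_simps)

lemma card_hexagon: "i \<le> 6 \<Longrightarrow> hexagon u v w i \<noteq> {} \<and> card (hexagon u v w i) \<le> 2"
  by (cases i rule: upto_6_cases) (auto simp: hexagon_simps card_insert_if)

definition heights :: "nat \<Rightarrow> (nat \<Rightarrow> nat) set" where
  "heights M = {h. h 0 = 0 \<and> (\<forall>t\<ge>M. h t = 6) \<and> (\<forall>t. h t \<le> 6) \<and> (\<forall>s t. near s t \<longrightarrow> near (h s) (h t))}"

text \<open>Raising the cutoff \<open>k\<close> from 0 to 6 deforms \<open>h\<close> into the
  maximum of \<open>h\<close> and \<open>h'\<close>, in steps that change values by at most one even
  between neighbouring times.\<close>

lemma heights_homotopy:
  assumes "h \<in> heights M" "h' \<in> heights M" "near s t" "k \<le> l" "l \<le> Suc k"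
  shows "near (max (h s) (min (h' s) k)) (max (h t) (min (h' t) l))"
proof -
  have "near (h s) (h t)" "near (h' s) (h' t)" using assms by (auto simp: heights_def)
  with assms(4,5) show ?thesis unfolding max_def min_def by (auto split: if_splits)
qed

text \<open>The corners may coincide; degenerate triangles later supply the vertex and edge
  trajectories.\<close>

locale triangle =
  fixes V :: "'a set" and G :: "'a \<Rightarrow> 'a \<Rightarrow> bool" and u v w :: 'a and M :: nat
  assumes graph: "graph_on V G" and uvw: "u \<in> V" "v \<in> V" "w \<in> V"
    and edges: "G u v" "G v w" "G u w" and M: "6 \<le> M"
begin

text \<open>Polar coordinates on the boundary of the prism: \<open>i\<close> is the meridian,
  \<open>a\<close> the height. The poles, at heights 0 and 6, are the full triangles, where the
  meridian does not matter.\<close>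

definition cell :: "nat \<Rightarrow> nat \<Rightarrow> 'a set \<times> nat" where
  "cell i = profile {u, v, w} (odd i) (hexagon u v w i)"

definition sweep :: "(nat \<Rightarrow> nat) \<Rightarrow> (nat \<Rightarrow> nat) \<Rightarrow> nat \<Rightarrow> 'a set \<times> nat" where
  "sweep h lab t = cell (lab t) (h t)"

lemma clique_uvw: "clique G {u, v, w}"
  using graph uvw edges unfolding graph_on_def clique_def by auto

lemma cell_ends: "cell i 0 = ({u, v, w}, 0)" "cell i 6 = ({u, v, w}, 1)"
  by (simp_all add: cell_def profile_simps)

lemma cell_6: "cell 6 = cell 0"
  by (simp add: cell_def hexagon_simps)

lemma profile_in_cells:
  assumes "i \<le> 6" "E = hexagon u v w i \<or> E = {u, v, w}"
  shows "profile E (odd i) (hexagon u v w i) a \<in> cells V G"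
proof -
  have "clique G (hexagon u v w i)" "hexagon u v w i \<subseteq> V"
    using clique_uvw hexagon_sub[OF assms(1), of u v w] uvw by (auto simp: clique_def)
  moreover have "card {u, v, w} \<le> 3" by (simp add: card_insert_if)
  ultimately show ?thesis
    using assms(2) card_hexagon[OF assms(1), of u v w] clique_uvw uvw unfolding cells_def profile_def
    by (auto split: if_splits)
qed

lemma comparable_hexagon_profiles:
  assumes "i \<le> 6" "j \<le> 6" "near i j" "a \<le> 6" "b \<le> 6" "near a b"
    "E = hexagon u v w i \<or> E = {u, v, w}" "E' = hexagon u v w j \<or> E' = {u, v, w}"
  shows "comparable (profile E (odd i) (hexagon u v w i) a) (profile E' (odd j) (hexagon u v w j) b)"
proof -
  have 1: "hexagon u v w i \<subseteq> hexagon u v w j \<or> hexagon u v w j \<subseteq> hexagon u v w i"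
    "odd i = odd j \<Longrightarrow> hexagon u v w i = hexagon u v w j"
  proof -
    show eq: "odd i = odd j \<Longrightarrow> hexagon u v w i = hexagon u v w j"
      using assms(3) by (metis even_Suc le_SucE le_antisym)
    show "hexagon u v w i \<subseteq> hexagon u v w j \<or> hexagon u v w j \<subseteq> hexagon u v w i"
      using eq hexagon_mono[OF assms(1-3), of u v w] hexagon_mono[OF assms(2,1), of u v w] assms(3) by auto
  qed
  have 2: "hexagon u v w i \<subseteq> {u, v, w}" "hexagon u v w j \<subseteq> {u, v, w}"
    using assms hexagon_sub by metis+
  show ?thesis
    by (rule comparable_profile)
      (use assms 1 2 hexagon_mono[OF assms(1-3), of u v w] hexagon_mono[OF assms(2,1), of u v w] in auto)
qed

lemma comparable_cells:
  assumes "i \<le> 6" "j \<le> 6" "a \<le> 6" "b \<le> 6" "near a b" "near i j \<or> a \<in> {0, 6} \<or> b \<in> {0, 6}"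
  shows "comparable (cell i a) (cell j b)"
proof (cases "near i j")
  case True
  then show ?thesis unfolding cell_def using comparable_hexagon_profiles assms by simp
next
  case False
  then consider "a = 0" | "a = 6" | "b = 0" | "b = 6" using assms by auto
  then show ?thesis
  proof cases
    case 1
    then have "cell i a = cell j a" by (simp add: cell_ends)
    then show ?thesis unfolding cell_def using comparable_hexagon_profiles[of j j] assms by simp
  next
    case 2
    then have "cell i a = cell j a" by (simp add: cell_ends)
    then show ?thesis unfolding cell_def using comparable_hexagon_profiles[of j j] assms by simp
  next
    case 3
    then have "cell j b = cell i b" by (simp add: cell_ends)
    then show ?thesis unfolding cell_def using comparable_hexagon_profiles[of i i] assms by simp
  next
    case 4
    then have "cell j b = cell i b" by (simp add: cell_ends)
    then show ?thesis unfolding cell_def using comparable_hexagon_profiles[of i i] assms by simp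
  qed
qed

lemma fellow_sweep:
  assumes "\<And>t. h t \<le> 6 \<and> h' t \<le> 6 \<and> lab t \<le> 6 \<and> lab' t \<le> 6"
    and "\<And>s t. near s t \<Longrightarrow>
      near (h s) (h' t) \<and> (near (lab s) (lab' t) \<or> h s \<in> {0, 6} \<or> h' t \<in> {0, 6})"
  shows "fellow (sweep h lab) (sweep h' lab')"
  unfolding fellow_def sweep_def using assms comparable_cells by meson

lemma sweep_in_trajectories:
  assumes h: "h \<in> heights M" and lab: "\<And>t. lab t \<le> 6"
    and f: "fellow (sweep h lab) (sweep h lab)"
  shows "sweep h lab \<in> trajectories V G M"
proof -
  have "sweep h lab t \<in> cells V G" for t
    unfolding sweep_def cell_def by (rule profile_in_cells) (use lab in auto)
  moreover have "fst (sweep h lab t) \<subseteq> {u, v, w}" for t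
    using hexagon_sub[OF lab, of u v w t] by (auto simp: sweep_def cell_def profile_def split: if_splits)
  ultimately show ?thesis
    using f h clique_uvw unfolding trajectories_def
    by (intro CollectI conjI exI[of _ "{u, v, w}"]) (auto simp: sweep_def heights_def cell_ends)
qed

text \<open>\<open>lab i t\<close> is the position on the hexagon at time \<open>t\<close> in the \<open>i\<close>-th curve of a loop.\<close>

definition labelling :: "(nat \<Rightarrow> nat \<Rightarrow> nat) \<Rightarrow> bool" where
  "labelling lab \<longleftrightarrow> (\<forall>i\<le>6. \<forall>t. lab i t \<le> 6) \<and> (\<forall>t. lab 6 t = lab 0 t \<or> lab 6 t = 6 \<and> lab 0 t = 0)"

text \<open>The labels may jump only at a pole where \<open>h\<close> and \<open>h'\<close> agree,
  so all intermediate heights are at that pole as well. Hence deforming the heights is a homotopy of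
  loops.\<close>

lemma loop_sum_sweep_max:
  assumes f: "cocycle (trajectories V G M) fellow f" and h: "h \<in> heights M" and h': "h' \<in> heights M"
    and lab: "labelling lab"
    and c: "\<And>i j s t. i \<le> 6 \<Longrightarrow> j \<le> 6 \<Longrightarrow> near i j \<Longrightarrow> near s t \<Longrightarrow>
      near (lab i s) (lab j t) \<or> h s \<in> {0, 6} \<and> h' s = h s \<or> h t \<in> {0, 6} \<and> h' t = h t"
  shows "loop_sum f (\<lambda>i. sweep h (lab i)) = loop_sum f (\<lambda>i. sweep (\<lambda>t. max (h t) (h' t)) (lab i))"
proof -
  define H where "H k t = max (h t) (min (h' t) k)" for k t
  have Hh: "H k \<in> heights M" for k
    unfolding heights_def
  proof (intro CollectI conjI allI impI)
    fix s t assume "near s t"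
    then show "H k s \<le> Suc (H k t)" "H k t \<le> Suc (H k s)"
      using heights_homotopy[OF h h', of s t k k] by (simp_all only: H_def order_refl le_SucI simp_thms)
  next
    fix t
    have "h t \<le> 6" "h' t \<le> 6" using h h' by (auto simp: heights_def)
    then show "H k t \<le> 6" by (simp add: H_def min.coboundedI1)
    show "H k t = 6" if "M \<le> t" using that h h' by (auto simp: H_def heights_def)
    show "H k 0 = 0" using h h' by (auto simp: H_def heights_def)
  qed
  have c': "near (H k s) (H l t) \<and> (near (lab i s) (lab j t) \<or> H k s \<in> {0, 6} \<or> H l t \<in> {0, 6})"
    if "i \<le> 6" "j \<le> 6" "near i j" "near s t" "k \<le> l" "l \<le> Suc k" for i j s t k l
  proof -
    have "near (H k s) (H l t)" unfolding H_def using heights_homotopy[OF h h' that(4-6)] .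
    moreover have "H k r \<in> {0, 6}" if "h r \<in> {0, 6} \<and> h' r = h r" for k r
      using that by (auto simp: H_def)
    ultimately show ?thesis using c[OF that(1-4)] by blast
  qed
  have fel: "fellow (sweep (H k) (lab i)) (sweep (H l) (lab j))"
    if "i \<le> 6" "j \<le> 6" "near i j" "k \<le> l" "l \<le> Suc k" for i j k l
  proof (rule fellow_sweep)
    show "H k t \<le> 6 \<and> H l t \<le> 6 \<and> lab i t \<le> 6 \<and> lab j t \<le> 6" for t
      using Hh[of k] Hh[of l] lab that(1,2) unfolding heights_def labelling_def by simp
  qed (use c' that in blast)
  have tr: "sweep (H k) (lab i) \<in> trajectories V G M" if "i \<le> 6" for i k
  proof (rule sweep_in_trajectories[OF Hh])
    show "lab i t \<le> 6" for t using lab that unfolding labelling_def by simp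
  qed (rule fel, use that in simp_all)
  have per: "sweep (H k) (lab 6) = sweep (H k) (lab 0)" for k
  proof
    fix t show "sweep (H k) (lab 6) t = sweep (H k) (lab 0) t"
      using lab cell_6 unfolding sweep_def labelling_def by metis
  qed
  have "loop_sum f (\<lambda>i. sweep (H k) (lab i)) = loop_sum f (\<lambda>i. sweep (H (Suc k)) (lab i))" for k
    by (rule loop_sum_homotopy[OF f]) (use fel tr per in simp_all)
  then have "loop_sum f (\<lambda>i. sweep (H 0) (lab i)) = loop_sum f (\<lambda>i. sweep (H k) (lab i))" for k
    by (induction k) auto
  from this[of 6] show ?thesis
  proof -
    have "H 0 = h" "H 6 = (\<lambda>t. max (h t) (h' t))"
      using h' by (auto simp: H_def heights_def fun_eq_iff min_absorb1)
    with \<open>loop_sum f (\<lambda>i. sweep (H 0) (lab i)) = loop_sum f (\<lambda>i. sweep (H 6) (lab i))\<close>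
    show ?thesis by simp
  qed
qed

text \<open>The deformation can only raise heights, so both functions are deformed to their
  maximum.\<close>

lemma loop_sum_sweep_heights:
  assumes f: "cocycle (trajectories V G M) fellow f" and h: "h \<in> heights M" and h': "h' \<in> heights M"
    and lab: "labelling lab"
    and c: "\<And>i j s t. i \<le> 6 \<Longrightarrow> j \<le> 6 \<Longrightarrow> near i j \<Longrightarrow> near s t \<Longrightarrow>
      near (lab i s) (lab j t) \<or> h s \<in> {0, 6} \<and> h' s = h s \<or> h t \<in> {0, 6} \<and> h' t = h t"
  shows "loop_sum f (\<lambda>i. sweep h (lab i)) = loop_sum f (\<lambda>i. sweep h' (lab i))"
proof -
  have "loop_sum f (\<lambda>i. sweep h' (lab i)) = loop_sum f (\<lambda>i. sweep (\<lambda>t. max (h' t) (h t)) (lab i))"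
  proof (rule loop_sum_sweep_max[OF f h' h lab])
    fix i j s t :: nat assume "i \<le> 6" "j \<le> 6" "near i j" "near s t"
    from c[OF this] show "near (lab i s) (lab j t) \<or> h' s \<in> {0, 6} \<and> h s = h' s \<or>
        h' t \<in> {0, 6} \<and> h t = h' t"
      by metis
  qed
  then show ?thesis using loop_sum_sweep_max[OF f h h' lab c] by (simp add: max.commute)
qed

end

section \<open>Many sweeps in succession\<close>

text \<open>There are \<open>K + 1\<close> ascents, starting at the multiples of 12 up to
  \<open>12 * K\<close>, with \<open>K\<close> descents between them.\<close>

definition zigzag :: "nat \<Rightarrow> nat \<Rightarrow> nat" where
  "zigzag K t = (if 12 * K + 6 \<le> t then 6 else if t mod 12 \<le> 6 then t mod 12 else 12 - t mod 12)"

lemma zigzag_heights: "zigzag K \<in> heights (12 * K + 6)"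
proof -
  have "near (zigzag K t) (zigzag K (Suc t))" for t
    unfolding zigzag_def by (cases "Suc t = 12 * K + 6") (auto simp: mod_Suc)
  moreover have "s = t \<or> t = Suc s \<or> s = Suc t" if "near s t" for s t using that by linarith
  ultimately have "near (zigzag K s) (zigzag K t)" if "near s t" for s t
    using that by (metis le_SucI order_refl)
  moreover have "zigzag K t \<le> 6" for t by (auto simp: zigzag_def)
  ultimately show ?thesis by (auto simp: heights_def zigzag_def)
qed

lemma zigzag_turn: "t mod 12 \<in> {0, 6} \<Longrightarrow> zigzag K t \<in> {0, 6}"
  by (auto simp: zigzag_def)

lemma zigzag_window:
  assumes "near s t"
  shows "s mod 12 \<in> {0, 6} \<or> t mod 12 \<in> {0, 6} \<or> 6 < s mod 12 \<and> 6 < t mod 12 \<or>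
    s mod 12 \<le> 6 \<and> t mod 12 \<le> 6 \<and> s div 12 = t div 12"
proof -
  have *: "Suc a mod 12 \<in> {0, 6} \<or> a mod 12 \<in> {0, 6} \<or> 6 < a mod 12 \<and> 6 < Suc a mod 12 \<or>
    a mod 12 \<le> 6 \<and> Suc a mod 12 \<le> 6 \<and> a div 12 = Suc a div 12" for a
    by (auto simp: mod_Suc div_Suc)
  consider "s = t" | "t = Suc s" | "s = Suc t" using assms by linarith
  then show ?thesis
  proof cases
    case 1 then show ?thesis by auto
  next
    case 2 then show ?thesis using *[of s] by auto
  next
    case 3 then show ?thesis using *[of t] by auto
  qed
qed

definition ramp :: "nat \<Rightarrow> nat \<Rightarrow> nat" where
  "ramp j t = min (t - 12 * j) 6"

lemma ramp_heights: "j \<le> K \<Longrightarrow> ramp j \<in> heights (12 * K + 6)"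
  unfolding heights_def ramp_def by auto

text \<open>For fixed \<open>j\<close> the parameters \<open>a\<close> and \<open>b\<close> span a
  torus of paths. On its diagonal all ascents up to the \<open>j\<close>-th move together, which is
  the loop of the parameter \<open>a\<close> for \<open>Suc j\<close>; this drives the induction on
  the number of sweeps.\<close>

definition two_labels :: "nat \<Rightarrow> nat \<Rightarrow> nat \<Rightarrow> nat \<Rightarrow> nat" where
  "two_labels j a b t =
     (if t mod 12 \<le> 6 then if t div 12 < j then a else if t div 12 = j then b else 0 else 0)"

lemma two_labels_0: "two_labels j 0 b t = (if 12 * j \<le> t \<and> t \<le> 12 * j + 6 then b else 0)"
proof -
  have "m \<le> 6 \<and> d = j \<longleftrightarrow> 12 * j \<le> 12 * d + m \<and> 12 * d + m \<le> 12 * j + 6" if "m < 12" for m d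
    using that by arith
  from this[of "t mod 12" "t div 12"]
  have "t mod 12 \<le> 6 \<and> t div 12 = j \<longleftrightarrow> 12 * j \<le> t \<and> t \<le> 12 * j + 6" by simp
  then show ?thesis by (auto simp: two_labels_def)
qed

text \<open>The label changes only between an ascent and a descent, and these are separated by a
  time at a pole.\<close>

lemma near_two_labels:
  assumes "near a a'" "near b b'" "near s t"
  shows "near (two_labels j a b s) (two_labels j a' b' t) \<or> zigzag K s \<in> {0, 6} \<or> zigzag K t \<in> {0, 6}"
proof -
  consider "s mod 12 \<in> {0, 6}" | "t mod 12 \<in> {0, 6}" | "6 < s mod 12" "6 < t mod 12"
    | "s mod 12 \<le> 6" "t mod 12 \<le> 6" "s div 12 = t div 12"
    using zigzag_window[OF assms(3)] by blast
  then show ?thesis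
  proof cases
    case 1 then show ?thesis using zigzag_turn[of s K] by simp
  next
    case 2 then show ?thesis using zigzag_turn[of t K] by simp
  next
    case 3 then show ?thesis by (simp add: two_labels_def)
  next
    case 4 then show ?thesis using assms(1,2) by (simp add: two_labels_def)
  qed
qed

text \<open>Outside the \<open>j\<close>-th ascent both labels are 0, and at its two ends
  \<open>zigzag K\<close> and \<open>ramp j\<close> are at the same pole. So the other ascents can
  be straightened out.\<close>

lemma near_single_window:
  assumes "near b b'" "near s t" "j \<le> K"
  shows "near (two_labels j 0 b s) (two_labels j 0 b' t) \<or>
    zigzag K s \<in> {0, 6} \<and> ramp j s = zigzag K s \<or> zigzag K t \<in> {0, 6} \<and> ramp j t = zigzag K t"
proof -
  have turn: "zigzag K r \<in> {0, 6} \<and> ramp j r = zigzag K r" if "r = 12 * j \<or> r = 12 * j + 6" for r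
    using that assms(3) by (auto simp: zigzag_def ramp_def)
  show ?thesis
  proof (cases "s = 12 * j \<or> s = 12 * j + 6 \<or> t = 12 * j \<or> t = 12 * j + 6")
    case True then show ?thesis using turn[of s] turn[of t] by argo
  next
    case False
    then have "12 * j \<le> s \<and> s \<le> 12 * j + 6 \<longleftrightarrow> 12 * j \<le> t \<and> t \<le> 12 * j + 6"
      using assms(2) by linarith
    then show ?thesis using assms(1) unfolding two_labels_0 by simp
  qed
qed

definition vertex_trajectory :: "'a \<Rightarrow> nat \<Rightarrow> 'a set \<times> nat" where
  "vertex_trajectory v t = profile {v} False {v} (min t 6)"

definition edge_trajectory :: "'a \<Rightarrow> 'a \<Rightarrow> nat \<Rightarrow> 'a set \<times> nat" where
  "edge_trajectory u v t = profile {u, v} True {u, v} (min t 6)"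

context triangle
begin

lemma sweep_two_labels_in_trajectories:
  assumes "M = 12 * K + 6" "a \<le> 6" "b \<le> 6"
  shows "sweep (zigzag K) (two_labels j a b) \<in> trajectories V G M"
    and "a' \<le> 6 \<Longrightarrow> b' \<le> 6 \<Longrightarrow> near a a' \<Longrightarrow> near b b' \<Longrightarrow>
      fellow (sweep (zigzag K) (two_labels j a b)) (sweep (zigzag K) (two_labels j a' b'))"
proof -
  have h: "zigzag K \<in> heights M" using zigzag_heights assms(1) by simp
  have *: "fellow (sweep (zigzag K) (two_labels j a b)) (sweep (zigzag K) (two_labels j a' b'))"
    if "a' \<le> 6" "b' \<le> 6" "near a a'" "near b b'" for a' b'
  proof (rule fellow_sweep)
    show "zigzag K t \<le> 6 \<and> zigzag K t \<le> 6 \<and> two_labels j a b t \<le> 6 \<and> two_labels j a' b' t \<le> 6" for t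
      using assms that h unfolding heights_def two_labels_def by simp
    show "near (zigzag K s) (zigzag K t) \<and>
       (near (two_labels j a b s) (two_labels j a' b' t) \<or> zigzag K s \<in> {0, 6} \<or> zigzag K t \<in> {0, 6})"
      if "near s t" for s t
      using near_two_labels[OF \<open>near a a'\<close> \<open>near b b'\<close> that] h that unfolding heights_def by simp
  qed
  show "sweep (zigzag K) (two_labels j a b) \<in> trajectories V G M"
  proof (rule sweep_in_trajectories[OF h])
    show "two_labels j a b t \<le> 6" for t using assms unfolding two_labels_def by simp
  qed (use * assms in simp)
  show "a' \<le> 6 \<Longrightarrow> b' \<le> 6 \<Longrightarrow> near a a' \<Longrightarrow> near b b' \<Longrightarrow>
      fellow (sweep (zigzag K) (two_labels j a b)) (sweep (zigzag K) (two_labels j a' b'))" by (rule *)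
qed

lemma sweep_two_labels_periodic:
  "sweep h (two_labels j 6 b) = sweep h (two_labels j 0 b)"
  "sweep h (two_labels j a 6) = sweep h (two_labels j a 0)"
  using cell_6 by (auto simp: sweep_def two_labels_def fun_eq_iff)

text \<open>The ascents along the fixed meridian 0 are deformed away. What remains waits at the
  bottom and climbs once; then the climb is moved to time 0.\<close>

lemma loop_sum_single_window:
  assumes f: "cocycle (trajectories V G M) fellow f" and M: "M = 12 * K + 6" and j: "j \<le> K"
  shows "loop_sum f (\<lambda>i. sweep (zigzag K) (two_labels j 0 i)) = loop_sum f (\<lambda>i. sweep (ramp 0) (\<lambda>_. i))"
proof -
  have Z: "zigzag K \<in> heights M" and R: "ramp j \<in> heights M" and R0: "ramp 0 \<in> heights M"
    using zigzag_heights ramp_heights[OF j] ramp_heights[of 0 K] M by simp_all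
  have "loop_sum f (\<lambda>i. sweep (zigzag K) (two_labels j 0 i)) = loop_sum f (\<lambda>i. sweep (ramp j) (two_labels j 0 i))"
  proof (rule loop_sum_sweep_heights[OF f Z R])
    show "labelling (two_labels j 0)" unfolding labelling_def two_labels_def by simp
  qed (use near_single_window j in blast)
  \<comment> \<open>Outside its climb the ramp rests at a pole, so the label may be taken constant
    in time.\<close>
  also have "(\<lambda>i. sweep (ramp j) (two_labels j 0 i)) = (\<lambda>i. sweep (ramp j) (\<lambda>_. i))"
  proof (intro ext)
    fix i t
    show "sweep (ramp j) (two_labels j 0 i) t = sweep (ramp j) (\<lambda>_. i) t"
    proof (cases "12 * j \<le> t \<and> t \<le> 12 * j + 6")
      case True
      then show ?thesis by (simp add: sweep_def two_labels_0)
    next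
      case False
      then have "ramp j t = 0 \<or> ramp j t = 6" by (auto simp: ramp_def)
      then show ?thesis by (auto simp: sweep_def cell_ends)
    qed
  qed
  also have "loop_sum f (\<lambda>i. sweep (ramp j) (\<lambda>_. i)) = loop_sum f (\<lambda>i. sweep (ramp 0) (\<lambda>_. i))"
    by (rule loop_sum_sweep_heights[OF f R R0]) (auto simp: labelling_def)
  finally show ?thesis .
qed

text \<open>Sweeping \<open>K + 1\<close> times in succession over the boundary of the prism gives \<open>K + 1\<close> times the
  value of a single sweep, but is still a loop of length 6.\<close>

lemma loop_sum_ramp:
  assumes f: "cocycle (trajectories V G M) fellow f"
    and b: "bounded_cochain (trajectories V G M) fellow B f"
    and M: "M = 12 * K + 6" and K: "6 * B < int (Suc K)"
  shows "loop_sum f (\<lambda>i. sweep (ramp 0) (\<lambda>_. i)) = 0"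
proof -
  define A where "A = loop_sum f (\<lambda>i. sweep (ramp 0) (\<lambda>_. i))"
  define x where "x j a b = sweep (zigzag K) (two_labels j a b)" for j a b
  have tr: "x j a b \<in> trajectories V G M" if "a \<le> 6" "b \<le> 6" for j a b
    unfolding x_def using sweep_two_labels_in_trajectories(1)[OF M that] .
  have fe: "fellow (x j a b) (x j a' b')"
    if "a \<le> 6" "b \<le> 6" "a' \<le> 6" "b' \<le> 6" "near a a'" "near b b'" for j a b a' b'
    unfolding x_def using sweep_two_labels_in_trajectories(2)[OF M that] .
  have diag: "x j a a = x (Suc j) a 0" for j a
    unfolding x_def by (intro arg_cong2[of _ _ _ _ sweep] refl) (auto simp: two_labels_def fun_eq_iff)
  have sum: "loop_sum f (\<lambda>i. x j i 0) = int j * A" if "j \<le> Suc K" for j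
    using that
  proof (induction j)
    case 0
    have "x 0 a 0 = x 0 0 0" for a
      unfolding x_def by (intro arg_cong2[of _ _ _ _ sweep] refl) (auto simp: two_labels_def fun_eq_iff)
    moreover have "f (x 0 0 0) (x 0 0 0) = 0"
      by (rule cocycle_refl[OF f]) (use tr fe in simp_all)
    ultimately have "f (x 0 i 0) (x 0 (Suc i) 0) = 0" for i by metis
    then show ?case unfolding loop_sum_def by simp
  next
    case (Suc j)
    have "loop_sum f (\<lambda>i. x j i i) = loop_sum f (\<lambda>i. x j i 0) + loop_sum f (x j 0)"
    proof (rule loop_sum_torus[OF f])
      show "x j 6 = x j 0" unfolding x_def using sweep_two_labels_periodic(1) by metis
    qed (use tr fe in simp_all)
    moreover have "loop_sum f (x j 0) = A"
      unfolding x_def A_def using loop_sum_single_window[OF f M, of j] Suc.prems by simp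
    ultimately show ?case using Suc diag by (simp add: algebra_simps)
  qed
  have "\<bar>loop_sum f (\<lambda>i. x (Suc K) i 0)\<bar> \<le> (\<Sum>i<6. \<bar>f (x (Suc K) i 0) (x (Suc K) (Suc i) 0)\<bar>)"
    unfolding loop_sum_def by (rule sum_abs)
  also have "\<dots> \<le> (\<Sum>i<(6::nat). B)"
    by (rule sum_mono) (use b tr fe in \<open>simp add: bounded_cochain_def\<close>)
  finally have "\<bar>int (Suc K) * A\<bar> \<le> 6 * B" using sum[of "Suc K"] by simp
  \<comment> \<open>Integrality enters here: a multiple of \<open>Suc K\<close> of absolute value
    less than \<open>Suc K\<close> is zero.\<close>
  then have "int (Suc K) * \<bar>A\<bar> < int (Suc K) * 1" using K by (simp only: abs_mult abs_of_nat mult_1_right)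
  then have "\<bar>A\<bar> < 1" by (rule mult_left_less_imp_less) simp
  then show ?thesis by (simp add: A_def)
qed

section \<open>Restricting cocycles from trajectories to the graph\<close>

text \<open>The path goes straight up the side of the prism and avoids the full triangles at its
  ends. So it depends only on a vertex or an edge, not on the triangle.\<close>

definition contour :: "nat \<Rightarrow> nat \<Rightarrow> 'a set \<times> nat" where
  "contour i t = profile (hexagon u v w i) (odd i) (hexagon u v w i) (min t 6)"

lemma fellow_contour:
  assumes "i \<le> 6" "j \<le> 6" "near i j"
  shows "fellow (contour i) (contour j)" "fellow (contour i) (sweep (ramp 0) (\<lambda>_. j))"
proof -
  have *: "near (min s 6) (min t 6)" if "near s t" for s t :: nat using that by auto
  show "fellow (contour i) (contour j)"
    unfolding fellow_def contour_def
    by (intro allI impI comparable_hexagon_profiles assms *) auto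
  show "fellow (contour i) (sweep (ramp 0) (\<lambda>_. j))"
    unfolding fellow_def contour_def sweep_def cell_def ramp_def diff_zero mult_0_right
    by (intro allI impI comparable_hexagon_profiles assms *) auto
qed

lemma contour_in_trajectories:
  assumes "i \<le> 6"
  shows "contour i \<in> trajectories V G M"
proof -
  have "contour i t \<in> cells V G" for t
    unfolding contour_def by (rule profile_in_cells) (use assms in auto)
  moreover have "fst (contour i t) \<subseteq> {u, v, w}" for t
    using hexagon_sub[OF assms, of u v w] by (auto simp: contour_def profile_def split: if_splits)
  moreover have "contour i t = contour i M" if "M \<le> t" for t
    using that M by (simp add: contour_def min_absorb2)
  moreover have "snd (contour i 0) = 0" "snd (contour i M) = 1"
    using M by (simp_all add: contour_def profile_simps min_absorb2)
  moreover have "fellow (contour i) (contour i)" using fellow_contour(1)[OF assms assms] by simp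
  ultimately show ?thesis using clique_uvw unfolding trajectories_def by blast
qed

lemma contour_eqs:
  "contour 0 = vertex_trajectory u" "contour 1 = edge_trajectory u v"
  "contour 2 = vertex_trajectory v" "contour 3 = edge_trajectory v w"
  "contour 4 = vertex_trajectory w" "contour 5 = edge_trajectory w u" "contour 6 = vertex_trajectory u"
  by (simp_all add: contour_def vertex_trajectory_def edge_trajectory_def hexagon_simps fun_eq_iff)

text \<open>Each contour is a fellow of the single sweep over the same position, and the loop of
  sweeps has sum zero. By \<open>contour_eqs\<close> the loop runs through the vertex and edge
  trajectories of the triangle.\<close>

lemma loop_sum_contour:
  assumes f: "cocycle (trajectories V G M) fellow f"
    and b: "bounded_cochain (trajectories V G M) fellow B f"
    and M: "M = 12 * K + 6" and K: "6 * B < int (Suc K)"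
  shows "loop_sum f contour = 0"
proof -
  have R: "ramp 0 \<in> heights M" using ramp_heights[of 0 K] M by simp
  have fe: "fellow (sweep (ramp 0) (\<lambda>_. i)) (sweep (ramp 0) (\<lambda>_. j))" if "i \<le> 6" "j \<le> 6" "near i j" for i j
    by (rule fellow_sweep) (use that R in \<open>auto simp: heights_def\<close>)
  have "loop_sum f contour = loop_sum f (\<lambda>i. sweep (ramp 0) (\<lambda>_. i))"
  proof (rule loop_sum_homotopy[OF f])
    fix i :: nat assume "i \<le> 6"
    then show "contour i \<in> trajectories V G M \<and> sweep (ramp 0) (\<lambda>_. i) \<in> trajectories V G M"
      using contour_in_trajectories sweep_in_trajectories[OF R] fe by simp
  next
    show "sweep (ramp 0) (\<lambda>_. 6) = sweep (ramp 0) (\<lambda>_. 0)"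
      by (simp add: sweep_def cell_6 fun_eq_iff)
  qed (use fellow_contour fe in \<open>simp_all add: contour_eqs\<close>)
  then show ?thesis using loop_sum_ramp[OF assms] by simp
qed

end

lemma (in triangle) contour_0_1:
  "vertex_trajectory u \<in> trajectories V G M" "edge_trajectory u v \<in> trajectories V G M"
  "fellow (vertex_trajectory u) (edge_trajectory u v)"
  "fellow (edge_trajectory u v) (vertex_trajectory v)"
  using contour_in_trajectories[of 0] contour_in_trajectories[of 1] fellow_contour(1)[of 0 1]
    fellow_contour(1)[of 1 2]
  by (simp_all add: contour_eqs contour_eqs(2)[unfolded One_nat_def])

lemma trajectories_cells: "\<omega> \<in> trajectories V G M \<Longrightarrow> \<omega> t \<in> cells V G"
  unfolding trajectories_def by blast

lemma trajectories_fellow: "\<omega> \<in> trajectories V G M \<Longrightarrow> fellow \<omega> \<omega>"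
  unfolding trajectories_def by blast

lemma trajectories_local:
  "\<omega> \<in> trajectories V G M \<Longrightarrow> \<exists>S. clique G S \<and> (\<forall>t. fst (\<omega> t) \<subseteq> S)"
  unfolding trajectories_def by blast

lemma cells_clique: "p \<in> cells V G \<Longrightarrow> fst p \<noteq> {} \<and> fst p \<subseteq> V \<and> clique G (fst p)"
  by (auto simp: cells_def)

lemma trajectory_vertex:
  assumes "\<omega> \<in> trajectories V G M"
  shows "pick (fst (\<omega> t)) \<in> fst (\<omega> t)" "pick (fst (\<omega> t)) \<in> V"
  using cells_clique[OF trajectories_cells[OF assms, of t]] pick_in[of "fst (\<omega> t)"] by auto

lemma loop_sum_eq:
  "loop_sum f x = f (x 0) (x 1) + f (x 1) (x 2) + f (x 2) (x 3) + f (x 3) (x 4) + f (x 4) (x 5) + f (x 5) (x 6)"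
  by (simp add: loop_sum_def eval_nat_numeral)

text \<open>An edge becomes a path of two edges, from one vertex trajectory to the other through the
  edge trajectory, hence the factor 2. The cocycle relation on a triangle is
  \<open>loop_sum_contour\<close>.\<close>

lemma graph_refines_trajectories:
  assumes G: "graph_on V G" and M: "M = 12 * K + 6" and K: "6 * B < int (Suc K)"
  shows "graph_refines V G (2 * B) (trajectories V G M) fellow B (\<lambda>\<omega>. pick (fst (\<omega> 0))) vertex_trajectory"
proof (rule graph_refinesI)
  have tri: "triangle V G u v w M" if "u \<in> V" "v \<in> V" "w \<in> V" "G u v" "G v w" "G u w" for u v w
    using that G M by unfold_locales auto
  have GD: "G x x" "G x y \<Longrightarrow> G y x" if "x \<in> V" "y \<in> V" for x y
    using G that by (auto simp: graph_on_def)
  let ?T = "trajectories V G M"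
  have e: "vertex_trajectory u \<in> ?T" "edge_trajectory u v \<in> ?T" "vertex_trajectory v \<in> ?T"
    "fellow (vertex_trajectory u) (edge_trajectory u v)"
    "fellow (edge_trajectory u v) (vertex_trajectory v)"
    if "u \<in> V" "v \<in> V" "G u v" for u v
    using triangle.contour_0_1[OF tri[of u v v]] triangle.contour_0_1(1)[OF tri[of v v v]] that GD
    by simp_all
  show "vertex_trajectory v \<in> ?T" if "v \<in> V" for v using e(1)[of v v] GD that by simp
  show "pick (fst (vertex_trajectory v 0)) = v" for v :: 'a
    by (simp add: vertex_trajectory_def profile_simps)
  show "pick (fst (\<omega> 0)) \<in> V" if "\<omega> \<in> ?T" for \<omega> using trajectory_vertex(2)[OF that] .
  show "G (pick (fst (\<omega> 0))) (pick (fst (\<eta> 0)))" if "\<omega> \<in> ?T" "\<eta> \<in> ?T" "fellow \<omega> \<eta>" for \<omega> \<eta>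
  proof -
    have "comparable (\<omega> 0) (\<eta> 0)" using that(3) by (simp add: fellow_def)
    then have "fst (\<omega> 0) \<subseteq> fst (\<eta> 0) \<or> fst (\<eta> 0) \<subseteq> fst (\<omega> 0)" by (auto simp: comparable_def)
    moreover have "clique G (fst (\<omega> 0))" "clique G (fst (\<eta> 0))"
      using cells_clique trajectories_cells that(1,2) by metis+
    ultimately show ?thesis
      using trajectory_vertex(1)[OF that(1), of 0] trajectory_vertex(1)[OF that(2), of 0]
      unfolding clique_def by blast
  qed
  fix f assume f: "cocycle ?T fellow f" and b: "bounded_cochain ?T fellow B f"
  define g where "g u v = f (vertex_trajectory u) (edge_trajectory u v)
    + f (edge_trajectory u v) (vertex_trajectory v)" for u v
  have fsym: "f y x = - f x y" if "x \<in> ?T" "y \<in> ?T" "fellow x y" for x y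
    by (rule cocycle_sym[OF f]) (use that fellow_sym[OF that(3)] trajectories_fellow[OF that(1)] in simp_all)
  have gsym: "g v u = - g u v" if "u \<in> V" "v \<in> V" "G u v" for u v
  proof -
    have "edge_trajectory v u = edge_trajectory u v"
      by (simp add: edge_trajectory_def insert_commute fun_eq_iff)
    then show ?thesis
      using fsym[OF e(1,2,4)[OF that]] fsym[OF e(2,3,5)[OF that]] unfolding g_def by simp
  qed
  have "cocycle V G g"
    unfolding cocycle_def
  proof (intro ballI impI)
    fix x y z assume V: "x \<in> V" "y \<in> V" "z \<in> V" and E: "G x y \<and> G y z \<and> G x z"
    interpret t: triangle V G x y z M by (rule tri) (use V E in auto)
    have "loop_sum f t.contour = 0" by (rule t.loop_sum_contour[OF f b M K])
    then have "g x y + g y z + g z x = 0"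
      unfolding loop_sum_eq t.contour_eqs g_def by simp
    then show "g x z = g x y + g y z" using gsym[of x z] V E by simp
  qed
  moreover have "bounded_cochain V G (2 * B) g"
    unfolding bounded_cochain_def
  proof (intro ballI impI)
    fix u v assume uv: "u \<in> V" "v \<in> V" "G u v"
    have "\<bar>f x y\<bar> \<le> B" if "x \<in> ?T" "y \<in> ?T" "fellow x y" for x y
      using b that by (simp add: bounded_cochain_def)
    from this[OF e(1,2,4)[OF uv]] this[OF e(2,3,5)[OF uv]]
    show "\<bar>g u v\<bar> \<le> 2 * B" unfolding g_def by linarith
  qed
  moreover have "sums_over_edges V G ?T fellow (\<lambda>\<omega>. pick (fst (\<omega> 0))) vertex_trajectory f g"
  proof (rule sums_over_edgesI)
    fix u v h assume uv: "u \<in> V" "v \<in> V" "G u v"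
      and h: "\<And>x y. x \<in> ?T \<Longrightarrow> y \<in> ?T \<Longrightarrow> pick (fst (x 0)) \<in> {u, v} \<Longrightarrow> pick (fst (y 0)) \<in> {u, v} \<Longrightarrow>
        fellow x y \<Longrightarrow> f x y = h y - h x"
    have "pick {u, v} \<in> {u, v}" by (rule pick_in) simp
    then have "pick (fst (edge_trajectory u v 0)) \<in> {u, v}"
      "pick (fst (vertex_trajectory u 0)) \<in> {u, v}" "pick (fst (vertex_trajectory v 0)) \<in> {u, v}"
      by (simp_all add: edge_trajectory_def vertex_trajectory_def profile_simps)
    then show "g u v = h (vertex_trajectory v) - h (vertex_trajectory u)"
      using h[OF e(1,2)[OF uv] _ _ e(4)[OF uv]] h[OF e(2,3)[OF uv] _ _ e(5)[OF uv]] unfolding g_def by simp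
  qed
  ultimately show "\<exists>g. cocycle V G g \<and> bounded_cochain V G (2 * B) g \<and>
      sums_over_edges V G ?T fellow (\<lambda>\<omega>. pick (fst (\<omega> 0))) vertex_trajectory f g" by blast
qed

section \<open>Coloured covers of the product with the line\<close>

text \<open>\<open>F\<close> sends a point of \<open>X \<times> \<int>\<close> to the name of a member of the cover that contains it,
  and \<open>c\<close> to the colour of that member.\<close>

definition colouring ::
  "'a set \<Rightarrow> ('a \<Rightarrow> 'a \<Rightarrow> bool) \<Rightarrow> ('a \<Rightarrow> 'a \<Rightarrow> bool) \<Rightarrow> int \<Rightarrow> ('a \<Rightarrow> int \<Rightarrow> 'n) \<Rightarrow> ('a \<Rightarrow> int \<Rightarrow> nat) \<Rightarrow> bool" where
  "colouring X E E' M F c \<longleftrightarrow>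
     (\<forall>x\<in>X. \<forall>s. c x s < 3) \<and>
     (\<forall>x\<in>X. \<forall>y\<in>X. \<forall>s t. E x y \<and> \<bar>s - t\<bar> \<le> 1 \<and> c x s = c y t \<longrightarrow> F x s = F y t) \<and>
     (\<forall>x\<in>X. \<forall>y\<in>X. \<forall>s t. F x s = F y t \<longrightarrow> \<bar>s - t\<bar> \<le> M \<and> (\<exists>z\<in>X. E' x z \<and> E' z y))"

lemma colouring_pullback:
  assumes c: "colouring X E E' M F c" and p: "\<And>x. x \<in> X' \<Longrightarrow> p x \<in> X"
    and q: "\<And>x. x \<in> X \<Longrightarrow> q x \<in> X'" "\<And>x. x \<in> X \<Longrightarrow> p (q x) = x"
    and E: "\<And>x y. x \<in> X' \<Longrightarrow> y \<in> X' \<Longrightarrow> E\<^sub>1 x y \<Longrightarrow> E (p x) (p y)"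
  shows "colouring X' E\<^sub>1 (\<lambda>x y. E' (p x) (p y)) M (\<lambda>x. F (p x)) (\<lambda>x. c (p x))"
  unfolding colouring_def
proof (intro conjI ballI allI impI)
  fix x s assume "x \<in> X'" then show "c (p x) s < 3" using c p by (simp add: colouring_def)
next
  fix x y s t assume "x \<in> X'" "y \<in> X'" "E\<^sub>1 x y \<and> \<bar>s - t\<bar> \<le> 1 \<and> c (p x) s = c (p y) t"
  then show "F (p x) s = F (p y) t" using c p[of x] p[of y] E[of x y] unfolding colouring_def by blast
next
  fix x y s t assume xy: "x \<in> X'" "y \<in> X'" "F (p x) s = F (p y) t"
  then have *: "\<bar>s - t\<bar> \<le> M" "\<exists>z\<in>X. E' (p x) z \<and> E' z (p y)"
    using c p[of x] p[of y] unfolding colouring_def by blast+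
  show "\<bar>s - t\<bar> \<le> M" by fact
  from *(2) q show "\<exists>z\<in>X'. E' (p x) (p z) \<and> E' (p z) (p y)" by metis
qed

text \<open>A trajectory, defined on \<open>{0..M}\<close>, is extended to \<open>\<int>\<close> by reflecting time at the multiples of
  \<open>M\<close>. The tags at the ends of \<open>{0..M}\<close> make it possible to cut a cell into pieces of bounded duration.\<close>

definition fold_time :: "nat \<Rightarrow> int \<Rightarrow> nat" where
  "fold_time M t = nat (if t mod (2 * int M) \<le> int M then t mod (2 * int M) else 2 * int M - t mod (2 * int M))"

text \<open>The cuts lie at folded times that a cell of type \<open>i\<close> on a trajectory never
  meets: \<open>M\<close> for a bottom cell, 0 for a top cell, both for a vertical cell.\<close>

definition period :: "nat \<Rightarrow> nat \<Rightarrow> int \<Rightarrow> int" where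
  "period M i t = (if i = 0 then (t + int M) div (2 * int M) else if i = 1 then t div (2 * int M) else t div int M)"

lemma int_succ_div_mod:
  fixes t m :: int
  assumes "0 < m"
  shows "(t + 1) mod m = 0 \<and> (t + 1) div m = t div m + 1 \<and> t mod m = m - 1 \<or>
    (t + 1) mod m = t mod m + 1 \<and> (t + 1) div m = t div m"
proof -
  have t: "t = m * (t div m) + t mod m" by simp
  have b: "0 \<le> t mod m" "t mod m < m" using assms by simp_all
  show ?thesis
  proof (cases "t mod m = m - 1")
    case True
    then have "t + 1 = m * (t div m) + m" using t by linarith
    then have e: "t + 1 = m * (t div m + 1) + 0" by (simp add: distrib_left)
    have "(t + 1) div m = t div m + 1" by (rule int_div_pos_eq[OF e]) (use assms in auto)
    moreover have "(t + 1) mod m = 0" by (rule int_mod_pos_eq[OF e]) (use assms in auto)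
    ultimately show ?thesis using True by simp
  next
    case False
    have e: "t + 1 = m * (t div m) + (t mod m + 1)" using t by linarith
    have "(t + 1) div m = t div m" by (rule int_div_pos_eq[OF e]) (use False b in auto)
    moreover have "(t + 1) mod m = t mod m + 1" by (rule int_mod_pos_eq[OF e]) (use False b in auto)
    ultimately show ?thesis by simp
  qed
qed

lemma int_near_cases:
  fixes s t :: int
  assumes "\<bar>s - t\<bar> \<le> 1"
  obtains "s = t" | "t = s + 1" | "s = t + 1"
  using assms by linarith

lemma near_fold_time:
  assumes "0 < M" "\<bar>s - t\<bar> \<le> 1"
  shows "near (fold_time M s) (fold_time M t)"
proof -
  have *: "near (fold_time M r) (fold_time M (r + 1))" for r
    using int_succ_div_mod[of "2 * int M" r] assms(1) pos_mod_sign[of "2 * int M" r]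
    unfolding fold_time_def by (auto split: if_splits)
  from assms(2) show ?thesis
    by (cases rule: int_near_cases) (use *[of s] *[of t] in auto)
qed

text \<open>The quotient changes from \<open>t\<close> to \<open>t + 1\<close> only if
  \<open>t + 1\<close> is a cut, so only the cell at the later time has to be known.\<close>

lemma period_step:
  assumes M: "0 < M"
    and 0: "i = 0 \<Longrightarrow> fold_time M (t + 1) \<noteq> M" and 1: "i = 1 \<Longrightarrow> fold_time M (t + 1) \<noteq> 0"
    and 2: "i \<noteq> 0 \<Longrightarrow> i \<noteq> 1 \<Longrightarrow> fold_time M (t + 1) \<notin> {0, M}"
  shows "period M i (t + 1) = period M i t"
proof -
  let ?m = "2 * int M"
  consider "i = 0" | "i = 1" | "i \<noteq> 0" "i \<noteq> 1" by blast
  then show ?thesis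
  proof cases
    case 1
    have "(t + 1) mod ?m = int M" if "(t + int M + 1) mod ?m = 0"
    proof -
      have "(t + 1) mod ?m = ((t + int M + 1) mod ?m + int M) mod ?m"
        by (simp add: mod_simps)
      then show ?thesis using that M by simp
    qed
    then have "(t + int M + 1) mod ?m \<noteq> 0" using 0 1 by (auto simp: fold_time_def)
    then show ?thesis using 1 int_succ_div_mod[of ?m "t + int M"] M
      by (auto simp: period_def algebra_simps)
  next
    case 2
    then have "(t + 1) mod ?m \<noteq> 0" using 1 by (auto simp: fold_time_def)
    then show ?thesis using 2 int_succ_div_mod[of ?m t] M by (auto simp: period_def)
  next
    case 3
    have "(t + 1) mod int M \<noteq> 0"
    proof
      assume "(t + 1) mod int M = 0"
      then obtain q where q: "t + 1 = int M * q" by (meson dvd_def dvd_eq_mod_eq_0)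
      have "(t + 1) mod ?m = int M * (q mod 2)"
        unfolding q using mult_mod_right[of "int M" q 2] by (simp only: mult.commute[of 2])
      moreover have "q mod 2 = 0 \<or> q mod 2 = 1" by auto
      ultimately have "fold_time M (t + 1) \<in> {0, M}" by (auto simp: fold_time_def)
      then show False using 2 3 by simp
    qed
    then show ?thesis using 3 int_succ_div_mod[of "int M" t] M by (auto simp: period_def)
  qed
qed

lemma period_bound:
  assumes "0 < M" "period M i s = period M i t"
  shows "\<bar>s - t\<bar> \<le> 2 * int M"
proof -
  have *: "\<bar>a - b\<bar> \<le> d" if "0 < d" "a div d = b div d" for a b d :: int
  proof -
    have "a = d * (a div d) + a mod d" "b = d * (b div d) + b mod d" by simp_all
    moreover have "d * (a div d) = d * (b div d)" using that(2) by simp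
    moreover have "0 \<le> a mod d" "a mod d < d" "0 \<le> b mod d" "b mod d < d" using that(1) by simp_all
    ultimately show ?thesis by linarith
  qed
  show ?thesis
    using *[of "2 * int M" "s + int M" "t + int M"] *[of "2 * int M" s t] *[of "int M" s t] assms
    unfolding period_def by (auto split: if_splits)
qed

text \<open>A piece consists of the points whose path is in a given cell during a given period.
  Neighbouring points are in incident cells, which coincide if they have the same dimension.\<close>

lemma colouring_trajectories:
  assumes G: "graph_on V G" and M: "6 \<le> M"
  shows "colouring (trajectories V G M) fellow (\<lambda>\<omega> \<eta>. G (pick (fst (\<omega> 0))) (pick (fst (\<eta> 0)))) (2 * int M)
    (\<lambda>\<omega> t. (fst (\<omega> (fold_time M t)), snd (\<omega> (fold_time M t)), period M (snd (\<omega> (fold_time M t))) t))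
    (\<lambda>\<omega> t. cell_dim (\<omega> (fold_time M t)) - 1)"
  unfolding colouring_def
proof (intro conjI ballI allI impI)
  let ?T = "trajectories V G M"
  have fin: "finite V" using G by (simp add: graph_on_def)
  have cel: "\<omega> r \<in> cells V G" if "\<omega> \<in> ?T" for \<omega> r using trajectories_cells[OF that] .
  have dim: "1 \<le> cell_dim p \<and> cell_dim p \<le> 3" if "p \<in> cells V G" for p
    using that fin unfolding cells_def cell_dim_def
    by (auto simp: Suc_le_eq card_gt_0_iff dest: finite_subset split: if_splits)
  show "cell_dim (\<omega> (fold_time M t)) - 1 < 3" if "\<omega> \<in> ?T" for \<omega> t
    using dim[OF cel[OF that], of "fold_time M t"] by linarith
  {
    fix \<omega> \<eta> s t assume T: "\<omega> \<in> ?T" "\<eta> \<in> ?T"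
      and a: "fellow \<omega> \<eta> \<and> \<bar>s - t\<bar> \<le> 1 \<and>
        cell_dim (\<omega> (fold_time M s)) - 1 = cell_dim (\<eta> (fold_time M t)) - 1"
    let ?p = "\<omega> (fold_time M s)" and ?q = "\<eta> (fold_time M t)"
    have "near (fold_time M s) (fold_time M t)" by (rule near_fold_time) (use a M in auto)
    then have "comparable ?p ?q" using a by (simp add: fellow_def)
    moreover have "cell_dim ?p = cell_dim ?q"
      using a dim[OF cel[OF T(1)], of "fold_time M s"] dim[OF cel[OF T(2)], of "fold_time M t"] by linarith
    ultimately have pq: "?p = ?q" using comparable_same_dim[OF cel[OF T(1)] cel[OF T(2)] _ _ fin] by blast
    define i where "i = snd ?p"
    have ends: "snd (\<omega> 0) = 0" "snd (\<eta> 0) = 0" "snd (\<omega> M) = 1" "snd (\<eta> M) = 1"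
      using T unfolding trajectories_def by blast+
    have step: "period M i (r + 1) = period M i r" if "snd (\<zeta> (fold_time M (r + 1))) = i"
      "snd (\<zeta> 0) = 0" "snd (\<zeta> M) = 1" for \<zeta> :: "nat \<Rightarrow> 'a set \<times> nat" and r
      by (rule period_step) (use M that in \<open>auto intro!: gr0I\<close>)
    have "period M i s = period M i t"
      using a[THEN conjunct2, THEN conjunct1]
    proof (cases rule: int_near_cases)
      case 2 then show ?thesis using step[of \<eta> s] ends pq i_def by simp
    next
      case 3 then show ?thesis using step[of \<omega> t] ends i_def by simp
    qed simp
    then show "(fst ?p, snd ?p, period M (snd ?p) s) = (fst ?q, snd ?q, period M (snd ?q) t)"
      using pq i_def by simp
  }
  {
    fix \<omega> \<eta> s t assume T: "\<omega> \<in> ?T" "\<eta> \<in> ?T"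
      and eq: "(fst (\<omega> (fold_time M s)), snd (\<omega> (fold_time M s)), period M (snd (\<omega> (fold_time M s))) s) =
        (fst (\<eta> (fold_time M t)), snd (\<eta> (fold_time M t)), period M (snd (\<eta> (fold_time M t))) t)"
    then show "\<bar>s - t\<bar> \<le> 2 * int M"
      using M period_bound[of M "snd (\<omega> (fold_time M s))" s t] by auto
    \<comment> \<open>The vertical trajectory over a vertex \<open>z\<close> of the common cell is
      the intermediate point: each of the two paths stays over a clique that contains
      \<open>z\<close>.\<close>
    define z where "z = pick (fst (\<omega> (fold_time M s)))"
    have z: "z \<in> fst (\<omega> (fold_time M s))" "z \<in> fst (\<eta> (fold_time M t))" "z \<in> V"
      using trajectory_vertex[OF T(1), of "fold_time M s"] eq by (auto simp: z_def)
    have loc: "G (pick (fst (\<zeta> 0))) z \<and> G z (pick (fst (\<zeta> 0)))" if z: "\<zeta> \<in> ?T" "z \<in> fst (\<zeta> r)" for \<zeta> r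
    proof -
      obtain S where "clique G S" "\<forall>t. fst (\<zeta> t) \<subseteq> S" using trajectories_local[OF z(1)] by blast
      then show ?thesis using trajectory_vertex(1)[OF z(1), of 0] z(2) unfolding clique_def by blast
    qed
    have "triangle V G z z z M" using z(3) G M by unfold_locales (auto simp: graph_on_def)
    then have "vertex_trajectory z \<in> ?T" by (rule triangle.contour_0_1)
    moreover have "pick (fst (vertex_trajectory z 0)) = z" by (simp add: vertex_trajectory_def profile_simps)
    ultimately show "\<exists>\<zeta>\<in>?T. G (pick (fst (\<omega> 0))) (pick (fst (\<zeta> 0))) \<and> G (pick (fst (\<zeta> 0))) (pick (fst (\<eta> 0)))"
      using loc T z by metis
  }
qed

section \<open>Towers of graphs\<close>

lemma refinement_step:
  fixes V :: "nat set"
  assumes G: "graph_on V G" and B: "0 \<le> B"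
  obtains V' :: "nat set" and G' \<pi> s M and F :: "nat \<Rightarrow> int \<Rightarrow> nat set \<times> nat \<times> int" and c
  where "graph_on V' G'" "graph_refines V G (8 * B) V' G' B \<pi> s"
    "\<And>x y z. x \<in> V' \<Longrightarrow> y \<in> V' \<Longrightarrow> z \<in> V' \<Longrightarrow> G' x y \<Longrightarrow> G' y z \<Longrightarrow> G (\<pi> x) (\<pi> z)"
    "colouring V' G' (\<lambda>x y. G (\<pi> x) (\<pi> y)) M F c"
proof -
  \<comment> \<open>The subdivision turns the bound \<open>B\<close> into \<open>4 * B\<close>, so
    the trajectories need \<open>6 * (4 * B) < Suc K\<close>.\<close>
  define K where "K = nat (24 * B)"
  define M where "M = 12 * K + 6"
  define T where "T = trajectories V G M"
  define I where "I = intervals T fellow"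
  have gT: "graph_on T fellow"
    unfolding T_def using graph_on_trajectories G by (auto simp: graph_on_def)
  then have gI: "graph_on I nested" unfolding I_def by (rule graph_on_intervals)
  define p where "p \<omega> = pick (fst (\<omega> 0))" for \<omega> :: "nat \<Rightarrow> nat set \<times> nat"
  have r1: "graph_refines V G (2 * (4 * B)) T fellow (4 * B) p vertex_trajectory"
    unfolding T_def p_def using graph_refines_trajectories[OF G M_def, of "4 * B"] B K_def by simp
  have r2: "graph_refines T fellow (4 * B) I nested B (pick \<circ> fst) (\<lambda>v. ({v}, {v}))"
    unfolding I_def by (rule graph_refines_intervals[OF gT])
  have "finite I" using gI by (simp add: graph_on_def)
  then obtain W :: "nat set" and r e where W: "inj_on e I" "W = e ` I" "r = the_inv_into I e"
    and r3: "\<And>B. graph_refines I nested B W (\<lambda>x y. nested (r x) (r y)) B r e"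
    using graph_refines_relabel[where V = I and G = nested] by metis
  define q where "q = pick \<circ> fst \<circ> r"
  have r23: "graph_refines T fellow (4 * B) W (\<lambda>x y. nested (r x) (r y)) B q (e \<circ> (\<lambda>v. ({v}, {v})))"
    unfolding q_def using graph_refines_trans[OF r2 r3] by (simp add: o_assoc)
  have "graph_on W (\<lambda>x y. nested (r x) (r y))"
    using \<open>finite I\<close> W(2) unfolding graph_on_def nested_def by auto
  moreover have "graph_refines V G (8 * B) W (\<lambda>x y. nested (r x) (r y)) B (p \<circ> q)
      ((e \<circ> (\<lambda>v. ({v}, {v}))) \<circ> vertex_trajectory)"
    using graph_refines_trans[OF r1 r23] by simp
  \<comment> \<open>This is what the subdivision is for: two steps of \<open>nested\<close> lie over
    one step of \<open>fellow\<close>, hence over an edge of \<open>G\<close>.\<close>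
  moreover have "G ((p \<circ> q) x) ((p \<circ> q) z)"
    if "x \<in> W" "y \<in> W" "z \<in> W" "nested (r x) (r y)" "nested (r y) (r z)" for x y z
  proof -
    have "fellow (q x) (q z)"
      unfolding q_def comp_def
      by (rule nested_contracts[of _ T fellow "r y"]) (use graph_refinesD(1)[OF r3] that in \<open>simp_all add: I_def\<close>)
    then show ?thesis using graph_refinesD(4)[OF r1] graph_refinesD(1)[OF r23] that by simp
  qed
  moreover have "colouring T fellow (\<lambda>\<omega> \<eta>. G (p \<omega>) (p \<eta>)) (2 * int M)
    (\<lambda>\<omega> t. (fst (\<omega> (fold_time M t)), snd (\<omega> (fold_time M t)), period M (snd (\<omega> (fold_time M t))) t))
    (\<lambda>\<omega> t. cell_dim (\<omega> (fold_time M t)) - 1)" (is "colouring _ _ _ ?M ?F ?c")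
    unfolding T_def p_def by (rule colouring_trajectories[OF G]) (simp add: M_def)
  then have "colouring W (\<lambda>x y. nested (r x) (r y)) (\<lambda>x y. G ((p \<circ> q) x) ((p \<circ> q) y)) ?M
      (\<lambda>x. ?F (q x)) (\<lambda>x. ?c (q x))"
    unfolding comp_apply
    by (rule colouring_pullback) (use graph_refinesD(1-4)[OF r23] in auto)
  ultimately show thesis by (rule that)
qed

text \<open>All floors are relations on the vertex set \<open>X\<close> of the finest graph; the top
  floor is pulled back from \<open>G\<close>. A bound grows by the factor 8 per floor.\<close>

definition tower ::
  "nat \<Rightarrow> nat set \<Rightarrow> (nat \<Rightarrow> nat \<Rightarrow> bool) \<Rightarrow> int \<Rightarrow> nat set \<Rightarrow> (nat \<Rightarrow> nat \<Rightarrow> nat \<Rightarrow> bool) \<Rightarrow>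
    (nat \<Rightarrow> nat) \<Rightarrow> (nat \<Rightarrow> nat) \<Rightarrow> bool" where
  "tower J V G B X E \<pi> s \<longleftrightarrow>
     (\<forall>i\<le>J. graph_on X (E i)) \<and>
     (\<forall>i<J. \<forall>x\<in>X. \<forall>y\<in>X. \<forall>z\<in>X. E i x y \<and> E i y z \<longrightarrow> E (Suc i) x z) \<and>
     (\<forall>x\<in>X. \<forall>y\<in>X. E J x y \<longleftrightarrow> G (\<pi> x) (\<pi> y)) \<and>
     (\<forall>i<J. \<exists>M (F :: nat \<Rightarrow> int \<Rightarrow> nat set \<times> nat \<times> int) c. colouring X (E i) (E (Suc i)) M F c) \<and>
     graph_refines V G (8 ^ J * B) X (E 0) B \<pi> s"

text \<open>The bound \<open>B\<close> is prescribed at the finest floor, so the number of sweeps on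
  a floor depends on how many floors lie below. Hence the induction first refines \<open>G\<close>
  for the bound \<open>8 ^ J * B\<close> and then builds a tower of height \<open>J\<close> below
  the refined graph.\<close>

lemma ex_tower:
  assumes "graph_on V G" "0 \<le> B"
  shows "\<exists>X E \<pi> s. tower J V G B X E \<pi> s"
  using assms(1)
proof (induction J arbitrary: V G)
  case 0
  then have "tower 0 V G B V (\<lambda>_. G) id id"
    unfolding tower_def using graph_refines_id by simp
  then show ?case by blast
next
  case (Suc J)
  have "0 \<le> 8 ^ J * B" using assms(2) by simp
  from refinement_step[OF Suc.prems this]
  obtain V' :: "nat set" and G' p q M and F :: "nat \<Rightarrow> int \<Rightarrow> nat set \<times> nat \<times> int" and c
    where g': "graph_on V' G'" and r': "graph_refines V G (8 * (8 ^ J * B)) V' G' (8 ^ J * B) p q"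
      and con: "\<And>x y z. x \<in> V' \<Longrightarrow> y \<in> V' \<Longrightarrow> z \<in> V' \<Longrightarrow> G' x y \<Longrightarrow> G' y z \<Longrightarrow> G (p x) (p z)"
      and col: "colouring V' G' (\<lambda>x y. G (p x) (p y)) M F c" by metis
  obtain X E \<pi> s where t: "tower J V' G' B X E \<pi> s" using Suc.IH[OF g'] by blast
  have r: "graph_refines V' G' (8 ^ J * B) X (E 0) B \<pi> s" using t by (simp add: tower_def)
  define E' where "E' i = (if i \<le> J then E i else (\<lambda>x y. G (p (\<pi> x)) (p (\<pi> y))))" for i
  have EJ: "E J x y \<longleftrightarrow> G' (\<pi> x) (\<pi> y)" if "x \<in> X" "y \<in> X" for x y
    using t that by (simp add: tower_def)
  have pV: "p (\<pi> x) \<in> V" if "x \<in> X" for x using graph_refinesD(1)[OF r] graph_refinesD(1)[OF r'] that by simp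
  have "finite X" using t by (auto simp: tower_def graph_on_def)
  have "tower (Suc J) V G B X E' (p \<circ> \<pi>) (s \<circ> q)"
    unfolding tower_def
  proof (intro conjI)
    have "graph_on X (\<lambda>x y. G (p (\<pi> x)) (p (\<pi> y)))"
      using Suc.prems \<open>finite X\<close> pV by (simp add: graph_on_def)
    then show "\<forall>i\<le>Suc J. graph_on X (E' i)"
      using t by (simp add: E'_def tower_def)
    show "\<forall>i<Suc J. \<forall>x\<in>X. \<forall>y\<in>X. \<forall>z\<in>X. E' i x y \<and> E' i y z \<longrightarrow> E' (Suc i) x z"
    proof (intro allI impI ballI)
      fix i x y z assume "i < Suc J" and X: "x \<in> X" "y \<in> X" "z \<in> X" and e: "E' i x y \<and> E' i y z"
      show "E' (Suc i) x z"
      proof (cases "i < J")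
        case True
        then have "\<forall>x\<in>X. \<forall>y\<in>X. \<forall>z\<in>X. E i x y \<and> E i y z \<longrightarrow> E (Suc i) x z"
          using t unfolding tower_def by blast
        then show ?thesis using X e True unfolding E'_def by (simp split: if_splits)
      next
        case False
        then have "i = J" using \<open>i < Suc J\<close> by simp
        then have "G' (\<pi> x) (\<pi> y)" "G' (\<pi> y) (\<pi> z)" using e X EJ by (simp_all add: E'_def)
        then show ?thesis
          using con[of "\<pi> x" "\<pi> y" "\<pi> z"] graph_refinesD(1)[OF r] X \<open>i = J\<close> by (simp add: E'_def)
      qed
    qed
    show "\<forall>x\<in>X. \<forall>y\<in>X. E' (Suc J) x y \<longleftrightarrow> G ((p \<circ> \<pi>) x) ((p \<circ> \<pi>) y)" by (simp add: E'_def)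
    show "\<forall>i<Suc J. \<exists>M (F :: nat \<Rightarrow> int \<Rightarrow> nat set \<times> nat \<times> int) c. colouring X (E' i) (E' (Suc i)) M F c"
    proof (intro allI impI)
      fix i assume "i < Suc J"
      show "\<exists>M (F :: nat \<Rightarrow> int \<Rightarrow> nat set \<times> nat \<times> int) c. colouring X (E' i) (E' (Suc i)) M F c"
      proof (cases "i < J")
        case True
        then show ?thesis using t by (simp add: E'_def tower_def)
      next
        case False
        then have "i = J" using \<open>i < Suc J\<close> by simp
        have "colouring X (E J) (\<lambda>x y. G (p (\<pi> x)) (p (\<pi> y))) M (\<lambda>x. F (\<pi> x)) (\<lambda>x. c (\<pi> x))"
          using col by (rule colouring_pullback) (use graph_refinesD(1-3)[OF r] EJ in auto)
        then show ?thesis unfolding \<open>i = J\<close> E'_def by auto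
      qed
    qed
    show "graph_refines V G (8 ^ Suc J * B) X (E' 0) B (p \<circ> \<pi>) (s \<circ> q)"
      using graph_refines_trans[OF r' r] by (simp add: E'_def mult.assoc)
  qed
  then show ?case by blast
qed

section \<open>Two colours do not suffice\<close>

text \<open>A triangulated disc with hub 6. The rim is long enough that \<open>{1, 2}\<close> has no
  edge to \<open>{4, 5}\<close>, and 3 has none to \<open>{5, 0, 1}\<close>.\<close>

definition wheel :: "nat \<Rightarrow> nat \<Rightarrow> bool" where
  "wheel i j \<longleftrightarrow> i = j \<or> i = 6 \<or> j = 6 \<or> j = (i + 1) mod 6 \<or> i = (j + 1) mod 6"

lemma graph_on_wheel: "graph_on {..6} wheel"
  unfolding graph_on_def wheel_def by auto

text \<open>Crossing the cut between \<open>0\<close> and \<open>1\<close> along the rim of the wheel defines a cocycle with values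
  in \<open>{-1, 0, 1}\<close> and total \<open>1\<close> around the rim, but the rim bounds the wheel.\<close>

lemma tower_not_two_colourable:
  assumes t: "tower J {..6} wheel 1 X E \<pi> s"
    and c: "\<And>x. x \<in> X \<Longrightarrow> c x < (2::nat)"
    and disj: "\<And>x y. x \<in> X \<Longrightarrow> y \<in> X \<Longrightarrow> E 0 x y \<Longrightarrow> c x = c y \<Longrightarrow> U x = U y"
    and bd: "\<And>x y. x \<in> X \<Longrightarrow> y \<in> X \<Longrightarrow> U x = U y \<Longrightarrow> E J x y"
  shows False
proof -
  have r: "graph_refines {..6} wheel (8 ^ J * 1) X (E 0) 1 \<pi> s" using t by (simp add: tower_def)
  have E0: "E 0 x x" "E 0 x y \<Longrightarrow> E 0 y x" if "x \<in> X" "y \<in> X" for x y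
    using t that by (auto simp: tower_def graph_on_def)
  \<comment> \<open>\<open>H\<close> marks the pieces that reach the vertices 1 and 2. The cochain
    \<open>f\<close> counts jumps of \<open>H\<close> only between pieces that reach 5, 0 or 1, so a
    tour of the rim meets the jump from 0 to 1 there, but not the jump back near the vertex
    3.\<close>
  define H :: "_ \<Rightarrow> int" where "H n = (if \<exists>z\<in>X. U z = n \<and> \<pi> z \<in> {1, 2} then 1 else 0)" for n
  define close where "close n \<longleftrightarrow> (\<exists>z\<in>X. U z = n \<and> \<pi> z \<in> {5, 0, 1})" for n
  define \<phi> where "\<phi> m n = (if close m \<and> close n then H n - H m else 0)" for m n
  define f where "f x y = \<phi> (U x) (U y)" for x y
  have adj: "wheel (\<pi> z) (\<pi> x)" if "x \<in> X" "z \<in> X" "U z = U x" for x z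
    using bd[of z x] that t by (simp add: tower_def)
  have H1: "H (U x) = 1" if "x \<in> X" "\<pi> x \<in> {1, 2}" for x
    using that unfolding H_def by auto
  have H0: "H (U x) = 0" if "x \<in> X" "\<pi> x \<in> {4, 5}" for x
  proof -
    have False if "z \<in> X" "U z = U x" "\<pi> z \<in> {1, 2}" for z
      using adj[OF \<open>x \<in> X\<close> that(1,2)] that(3) \<open>\<pi> x \<in> {4, 5}\<close> by (auto simp: wheel_def)
    then show ?thesis unfolding H_def by auto
  qed
  have close: "close (U x)" if "x \<in> X" "\<pi> x \<in> {5, 0, 1}" for x
    using that unfolding close_def by blast
  have far: "\<not> close (U x)" if "x \<in> X" "\<pi> x = 3" for x
  proof -
    have False if "z \<in> X" "U z = U x" "\<pi> z \<in> {5, 0, 1}" for z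
      using adj[OF \<open>x \<in> X\<close> that(1,2)] that(3) \<open>\<pi> x = 3\<close> by (auto simp: wheel_def)
    then show ?thesis unfolding close_def by blast
  qed
  have coc: "cocycle X (E 0) f"
    unfolding cocycle_def
  proof (intro ballI impI)
    fix x y z assume X: "x \<in> X" "y \<in> X" "z \<in> X" and e: "E 0 x y \<and> E 0 y z \<and> E 0 x z"
    \<comment> \<open>Of three pairwise linked points two have the same colour and so lie in one
      piece. Then the relation is trivial, as \<open>\<phi>\<close> is antisymmetric.\<close>
    have "c x = c y \<or> c y = c z \<or> c x = c z" using c[OF X(1)] c[OF X(2)] c[OF X(3)] by linarith
    then have "U x = U y \<or> U y = U z \<or> U x = U z" using disj X e by blast
    then show "f x z = f x y + f y z" unfolding f_def \<phi>_def by auto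
  qed
  have "bounded_cochain X (E 0) 1 f"
    unfolding bounded_cochain_def f_def \<phi>_def H_def by simp
  with coc obtain g where g: "cocycle {..6} wheel g" and gf: "sums_over_edges {..6} wheel X (E 0) \<pi> s f g"
    using graph_refinesD(5)[OF r] by blast
  \<comment> \<open>Every rim edge spans a triangle with the hub, so the sum over the rim telescopes
    to zero.\<close>
  have rim: "g i j = g i 6 - g j 6" if "i < 6" "j < 6" "wheel i j" for i j
    using cocycleD[OF g, of i 6 j] cocycle_sym[OF g, of j 6] that by (simp add: wheel_def)
  have "g 0 1 + g 1 2 + g 2 3 + g 3 4 + g 4 5 + g 5 0 = 0"
    using rim[of 0 1] rim[of 1 2] rim[of 2 3] rim[of 3 4] rim[of 4 5] rim[of 5 0]
    by (simp add: wheel_def)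
  moreover have sX: "s i \<in> X \<and> \<pi> (s i) = i" if "i < 6" for i
    using graph_refinesD(2,3)[OF r, of i] that by simp
  have "g 0 1 = H (U (s 1)) - H (U (s 0))"
    by (rule sums_over_edgesD[OF gf, where h = "\<lambda>x. H (U x)"]) (auto simp: wheel_def f_def \<phi>_def close)
  moreover have "g 5 0 = H (U (s 0)) - H (U (s 5))"
    by (rule sums_over_edgesD[OF gf, where h = "\<lambda>x. H (U x)"]) (auto simp: wheel_def f_def \<phi>_def close)
  \<comment> \<open>Over these four edges the zero function is a potential: \<open>H\<close> is
    constant on the pieces concerned unless one of them is not \<open>close\<close>.\<close>
  moreover have "g 1 2 = 0 - 0"
    by (rule sums_over_edgesD[OF gf, where h = "\<lambda>x. 0"]) (auto simp: wheel_def f_def \<phi>_def H1)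
  moreover have "g 2 3 = 0 - 0"
    by (rule sums_over_edgesD[OF gf, where h = "\<lambda>x. 0"]) (auto simp: wheel_def f_def \<phi>_def H1 far)
  moreover have "g 3 4 = 0 - 0"
    by (rule sums_over_edgesD[OF gf, where h = "\<lambda>x. 0"]) (auto simp: wheel_def f_def \<phi>_def H0 far)
  moreover have "g 4 5 = 0 - 0"
    by (rule sums_over_edgesD[OF gf, where h = "\<lambda>x. 0"]) (auto simp: wheel_def f_def \<phi>_def H0)
  moreover have "H (U (s 1)) = 1" "H (U (s 5)) = 0" using H1[of "s 1"] H0[of "s 5"] sX[of 1] sX[of 5] by simp_all
  ultimately show False by simp
qed

section \<open>Asymptotic Assouad-Nagata dimension through coloured covers\<close>

text \<open>The members of the cover are the joint fibres of \<open>F\<close> and \<open>c\<close>,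
  so disjointness is a condition on pairs of points and no sets have to be handled.\<close>

lemma asdim_AN_leI:
  fixes M :: "'a set"
  assumes nonneg: "\<And>r. 0 \<le> r \<Longrightarrow> 0 \<le> A * r + B"
    and cover: "\<And>r. 0 \<le> r \<Longrightarrow> \<exists>(F :: 'a \<Rightarrow> 'n) (c :: 'a \<Rightarrow> nat). \<forall>x\<in>M. c x \<le> n \<and>
      (\<forall>y\<in>M. (d x y < r \<and> c x = c y \<longrightarrow> F x = F y) \<and> (F x = F y \<longrightarrow> d x y \<le> A * r + B))"
  shows "asdim_AN_le M d n"
  unfolding asdim_AN_le_def control_function_def
proof (rule exI[of _ A], rule exI[of _ B], intro conjI allI impI)
  show "0 \<le> A * r + B" if "0 \<le> r" for r using nonneg[OF that] .
  fix r :: real assume "0 \<le> r"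
  from cover[OF this] obtain F :: "'a \<Rightarrow> 'n" and c :: "'a \<Rightarrow> nat" where c: "\<And>x. x \<in> M \<Longrightarrow> c x \<le> n"
    and F: "\<And>x y. x \<in> M \<Longrightarrow> y \<in> M \<Longrightarrow> d x y < r \<Longrightarrow> c x = c y \<Longrightarrow> F x = F y"
    and b: "\<And>x y. x \<in> M \<Longrightarrow> y \<in> M \<Longrightarrow> F x = F y \<Longrightarrow> d x y \<le> A * r + B" by metis
  \<comment> \<open>Colours start at 0, the families of the cover at 1.\<close>
  define \<U> where "\<U> i = (\<lambda>x. {y \<in> M. F y = F x \<and> c y = c x}) ` {x \<in> M. Suc (c x) = i}" for i
  show "\<exists>\<U>. (\<forall>i\<in>{1..n + 1}. \<U> i \<subseteq> Pow M) \<and> \<Union> (\<Union>i\<in>{1..n + 1}. \<U> i) = M \<and>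
      (\<forall>i\<in>{1..n + 1}. r_disjoint d r (\<U> i)) \<and>
      (\<forall>U\<in>\<Union>i\<in>{1..n + 1}. \<U> i. ediameter d U \<le> ennreal (A * r + B))"
  proof (intro exI[of _ \<U>] conjI ballI)
    show "\<U> i \<subseteq> Pow M" for i by (auto simp: \<U>_def)
    show "\<Union> (\<Union>i\<in>{1..n + 1}. \<U> i) = M"
    proof
      show "M \<subseteq> \<Union> (\<Union>i\<in>{1..n + 1}. \<U> i)"
      proof
        fix x assume "x \<in> M"
        then show "x \<in> \<Union> (\<Union>i\<in>{1..n + 1}. \<U> i)"
          using c[of x] by (intro UnionI[of "{y \<in> M. F y = F x \<and> c y = c x}"]) (auto simp: \<U>_def)
      qed
    qed (auto simp: \<U>_def)
    show "r_disjoint d r (\<U> i)" for i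
      unfolding r_disjoint_def
    proof (intro ballI impI)
      fix U V x y assume U: "U \<in> \<U> i" and V: "V \<in> \<U> i" and "U \<noteq> V" and xy: "x \<in> U" "y \<in> V"
      have "F x \<noteq> F y" "c x = c y" "x \<in> M" "y \<in> M"
        using U V xy \<open>U \<noteq> V\<close> unfolding \<U>_def by auto
      then show "r \<le> d x y" using F[of x y] by linarith
    qed
    fix U assume "U \<in> (\<Union>i\<in>{1..n + 1}. \<U> i)"
    then have "d x y \<le> A * r + B" if "x \<in> U" "y \<in> U" for x y
      using that b[of x y] by (auto simp: \<U>_def)
    then show "ediameter d U \<le> ennreal (A * r + B)"
      unfolding ediameter_def by (intro SUP_least ennreal_leI)
  qed
qed

text \<open>Each point chooses a member containing it and a family containing that member; the
  member itself serves as the name.\<close>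

lemma asdim_AN_leD:
  fixes M :: "'a set"
  assumes "asdim_AN_le M d n"
  obtains A B where "\<And>r. 0 \<le> r \<Longrightarrow> 0 \<le> A * r + B"
    "\<And>r. 0 \<le> r \<Longrightarrow> \<exists>(F :: 'a \<Rightarrow> 'a set) (c :: 'a \<Rightarrow> nat). \<forall>x\<in>M. c x \<le> n \<and>
      (\<forall>y\<in>M. (d x y < r \<and> c x = c y \<longrightarrow> F x = F y) \<and> (F x = F y \<longrightarrow> d x y \<le> A * r + B))"
proof -
  obtain A B where AB: "\<And>r. 0 \<le> r \<Longrightarrow> 0 \<le> A * r + B"
    and cf: "control_function n M d (\<lambda>r. ennreal (A * r + B))"
    using assms unfolding asdim_AN_le_def by blast
  show thesis
  proof (rule that[of A B])
    show "0 \<le> A * r + B" if "0 \<le> r" for r using AB[OF that] .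
    fix r :: real assume r: "0 \<le> r"
    obtain \<U> where cov: "\<Union> (\<Union>i\<in>{1..n + 1}. \<U> i) = M"
      and dis: "\<And>i. i \<in> {1..n + 1} \<Longrightarrow> r_disjoint d r (\<U> i)"
      and dia: "\<And>i U. i \<in> {1..n + 1} \<Longrightarrow> U \<in> \<U> i \<Longrightarrow> ediameter d U \<le> ennreal (A * r + B)"
      using cf r unfolding control_function_def by (metis UN_I)
    have "\<exists>p. fst p \<in> {1..n + 1} \<and> snd p \<in> \<U> (fst p) \<and> x \<in> snd p" if "x \<in> M" for x
      using that cov by auto
    then obtain p where p: "\<And>x. x \<in> M \<Longrightarrow> fst (p x) \<in> {1..n + 1} \<and> snd (p x) \<in> \<U> (fst (p x)) \<and> x \<in> snd (p x)"
      by metis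
    show "\<exists>(F :: 'a \<Rightarrow> 'a set) (c :: 'a \<Rightarrow> nat). \<forall>x\<in>M. c x \<le> n \<and>
      (\<forall>y\<in>M. (d x y < r \<and> c x = c y \<longrightarrow> F x = F y) \<and> (F x = F y \<longrightarrow> d x y \<le> A * r + B))"
    proof (intro exI[of _ "\<lambda>x. snd (p x)"] exI[of _ "\<lambda>x. fst (p x) - 1"] ballI conjI impI)
      fix x assume x: "x \<in> M"
      show "fst (p x) - 1 \<le> n" using p[OF x] by auto
      fix y assume y: "y \<in> M"
      show "snd (p x) = snd (p y)" if "d x y < r \<and> fst (p x) - 1 = fst (p y) - 1"
      proof (rule ccontr)
        assume ne: "snd (p x) \<noteq> snd (p y)"
        have "fst (p x) = fst (p y)" using that p[OF x] p[OF y] by auto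
        then have "r \<le> d x y" using dis[of "fst (p x)"] ne p[OF x] p[OF y] unfolding r_disjoint_def by metis
        then show False using that by simp
      qed
      show "d x y \<le> A * r + B" if "snd (p x) = snd (p y)"
      proof -
        have "ennreal (d x y) \<le> ediameter d (snd (p x))"
          unfolding ediameter_def using p[OF x] p[OF y] that
          by (intro SUP_upper2[of x] SUP_upper2[of y]) auto
        also have "\<dots> \<le> ennreal (A * r + B)" using dia p[OF x] by blast
        finally show ?thesis using AB[OF r] by (simp add: ennreal_le_iff)
      qed
    qed
  qed
qed

lemma asdim_AN_le_embedding:
  fixes M :: "'a set" and M' :: "'b set"
  assumes "asdim_AN_le M' d' n" "n \<le> m" and f: "\<And>x. x \<in> M \<Longrightarrow> f x \<in> M'"
    and d: "\<And>x y. x \<in> M \<Longrightarrow> y \<in> M \<Longrightarrow> d' (f x) (f y) = d x y"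
  shows "asdim_AN_le M d m"
  using assms(1)
proof (rule asdim_AN_leD)
  fix A B
  assume nn: "\<And>r. 0 \<le> r \<Longrightarrow> 0 \<le> A * r + B"
    and cov: "\<And>r. 0 \<le> r \<Longrightarrow> \<exists>(F :: 'b \<Rightarrow> 'b set) (c :: 'b \<Rightarrow> nat). \<forall>x\<in>M'. c x \<le> n \<and>
      (\<forall>y\<in>M'. (d' x y < r \<and> c x = c y \<longrightarrow> F x = F y) \<and> (F x = F y \<longrightarrow> d' x y \<le> A * r + B))"
  show ?thesis
  proof (rule asdim_AN_leI[OF nn])
    fix r :: real assume "0 \<le> r"
    from cov[OF this] obtain F :: "'b \<Rightarrow> 'b set" and c :: "'b \<Rightarrow> nat"
      where Fc: "\<forall>x\<in>M'. c x \<le> n \<and>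
        (\<forall>y\<in>M'. (d' x y < r \<and> c x = c y \<longrightarrow> F x = F y) \<and> (F x = F y \<longrightarrow> d' x y \<le> A * r + B))" by blast
    show "\<exists>(F :: 'a \<Rightarrow> 'b set) (c :: 'a \<Rightarrow> nat). \<forall>x\<in>M. c x \<le> m \<and>
      (\<forall>y\<in>M. (d x y < r \<and> c x = c y \<longrightarrow> F x = F y) \<and> (F x = F y \<longrightarrow> d x y \<le> A * r + B))"
    proof (intro exI[of _ "\<lambda>x. F (f x)"] exI[of _ "\<lambda>x. c (f x)"] ballI conjI)
      fix x assume x: "x \<in> M"
      show "c (f x) \<le> m" using Fc f[OF x] assms(2) by (meson order_trans)
      fix y assume y: "y \<in> M"
      show "d x y < r \<and> c (f x) = c (f y) \<longrightarrow> F (f x) = F (f y)" "F (f x) = F (f y) \<longrightarrow> d x y \<le> A * r + B"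
        using Fc f[OF x] f[OF y] d[OF x y] by metis+
    qed
  qed
qed

lemma asdim_AN_eqI:
  assumes "asdim_AN_le M d (Suc n)" "\<not> asdim_AN_le M d n"
  shows "asdim_AN M d = enat (Suc n)"
  unfolding asdim_AN_def
proof (rule antisym)
  show "Inf {enat m |m. asdim_AN_le M d m} \<le> enat (Suc n)"
    using assms(1) by (intro Inf_lower) auto
  show "enat (Suc n) \<le> Inf {enat m |m. asdim_AN_le M d m}"
  proof (rule Inf_greatest)
    fix k assume "k \<in> {enat m |m. asdim_AN_le M d m}"
    then obtain m where m: "k = enat m" "asdim_AN_le M d m" by auto
    have "\<not> m \<le> n" using asdim_AN_le_embedding[OF m(2), of n M "\<lambda>x. x" d] assms(2) by auto
    then show "enat (Suc n) \<le> k" using m(1) by simp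
  qed
qed

section \<open>Slowly growing metrics on the line\<close>

text \<open>The factor \<open>real n + 1\<close> makes \<open>slow\<close> at least \<open>n\<close>
  at the \<open>n\<close>-th breakpoint; the summand \<open>b n\<close> allows the growth to be
  prescribed.\<close>

primrec breakpoint :: "(nat \<Rightarrow> real) \<Rightarrow> nat \<Rightarrow> real" where
  "breakpoint b 0 = 1"
| "breakpoint b (Suc n) = breakpoint b n * (real n + 1 + b n)"

text \<open>For positive breakpoints this is an infimum of nondecreasing affine functions that are
  nonnegative for \<open>t \<ge> 0\<close>, hence nondecreasing, concave and subadditive
  there.\<close>

definition slow :: "(nat \<Rightarrow> real) \<Rightarrow> real \<Rightarrow> real" where
  "slow b t = (INF n. real n + t / breakpoint b n)"

locale breakpoints =
  fixes b :: "nat \<Rightarrow> real"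
  assumes b: "\<And>n. 0 \<le> b n"
begin

lemma breakpoint_ge_1: "1 \<le> breakpoint b n"
proof (induction n)
  case (Suc n)
  have "1 * 1 \<le> breakpoint b n * (real n + 1 + b n)"
    by (rule mult_mono) (use Suc b[of n] in auto)
  then show ?case by simp
qed simp

lemma breakpoint_pos: "0 < breakpoint b n"
  using breakpoint_ge_1[of n] by simp

lemma breakpoint_Suc: "(real n + 1) * breakpoint b n \<le> breakpoint b (Suc n)"
  using breakpoint_pos[of n] b[of n] by (simp add: mult.commute mult_le_cancel_left)

lemma breakpoint_mono: "m \<le> n \<Longrightarrow> breakpoint b m \<le> breakpoint b n"
proof (rule lift_Suc_mono_le[of "breakpoint b"])
  show "breakpoint b n \<le> breakpoint b (Suc n)" for n
    using mult_right_mono[of 1 "real n + 1" "breakpoint b n"] breakpoint_Suc[of n] breakpoint_pos[of n] by simp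
qed

lemma breakpoint_ge_index: "real n \<le> breakpoint b n"
proof (cases n)
  case (Suc m)
  have "real n * 1 \<le> (real m + 1) * breakpoint b m" 
    unfolding Suc by (intro mult_mono) (use breakpoint_ge_1[of m] in auto)
  then show ?thesis using breakpoint_Suc[of m] Suc by simp
qed simp

lemma slow_le: "0 \<le> t \<Longrightarrow> slow b t \<le> real n + t / breakpoint b n"
  unfolding slow_def
  by (rule cINF_lower) (use breakpoint_pos less_imp_le in \<open>auto intro!: bdd_belowI[of _ 0] add_nonneg_nonneg divide_nonneg_pos\<close>)

lemma slow_greatest: "(\<And>n. a \<le> real n + t / breakpoint b n) \<Longrightarrow> a \<le> slow b t"
  unfolding slow_def by (rule cINF_greatest) auto

lemma slow_nonneg: "0 \<le> t \<Longrightarrow> 0 \<le> slow b t"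
  by (rule slow_greatest) (simp add: breakpoint_pos less_imp_le)

lemma slow_le_arg: "0 \<le> t \<Longrightarrow> slow b t \<le> t"
  using slow_le[of t 0] by simp

lemma slow_mono: "0 \<le> s \<Longrightarrow> s \<le> t \<Longrightarrow> slow b s \<le> slow b t"
proof (rule slow_greatest)
  fix n assume "0 \<le> s" "s \<le> t"
  then show "slow b s \<le> real n + t / breakpoint b n"
    using slow_le[of s n] divide_right_mono[of s t "breakpoint b n"] breakpoint_pos[of n] by simp
qed

lemma slow_le_of_le_breakpoint: "0 \<le> t \<Longrightarrow> t \<le> breakpoint b n \<Longrightarrow> slow b t \<le> real n + 1"
  using slow_le[of t n] breakpoint_pos[of n] divide_le_eq_1_pos[of "breakpoint b n" t] by linarith

text \<open>Terms of index at least \<open>n\<close> are large by their constant part. For a smaller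
  index the quotient is at least \<open>n\<close>, because the breakpoints grow at least by the
  factor \<open>n\<close> from \<open>n - 1\<close> to \<open>n\<close>.\<close>

lemma slow_ge_of_ge_breakpoint: "breakpoint b n \<le> t \<Longrightarrow> real n \<le> slow b t"
proof (rule slow_greatest)
  fix m assume t: "breakpoint b n \<le> t"
  show "real n \<le> real m + t / breakpoint b m"
  proof (cases "n \<le> m")
    case True
    then show ?thesis using t breakpoint_pos[of n] breakpoint_pos[of m] by (simp add: add_increasing2)
  next
    case False
    then obtain k where k: "n = Suc k" "m \<le> k" by (metis Suc_le_D not_less_eq_eq)
    have "real n * breakpoint b m \<le> (real k + 1) * breakpoint b k"
      using breakpoint_mono[OF k(2)] breakpoint_pos[of m] k(1) by (intro mult_mono) auto
    also have "\<dots> \<le> t" using breakpoint_Suc[of k] k(1) t by simp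
    finally have "real n \<le> t / breakpoint b m" using breakpoint_pos[of m] by (simp add: field_simps)
    then show ?thesis by simp
  qed
qed

text \<open>Term \<open>m\<close> for \<open>s\<close> and term \<open>n\<close> for
  \<open>t\<close> are compared with term \<open>max m n\<close> for \<open>s + t\<close>: its
  denominator is no smaller, and its constant is at most \<open>m + n\<close>.\<close>

lemma slow_subadditive:
  assumes "0 \<le> s" "0 \<le> t"
  shows "slow b (s + t) \<le> slow b s + slow b t"
proof -
  have *: "slow b (s + t) \<le> (real m + s / breakpoint b m) + (real n + t / breakpoint b n)" for m n
  proof -
    let ?k = "max m n"
    have "s / breakpoint b ?k \<le> s / breakpoint b m" "t / breakpoint b ?k \<le> t / breakpoint b n"
      using assms breakpoint_pos breakpoint_mono by (auto intro!: divide_left_mono)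
    then show ?thesis using slow_le[of "s + t" ?k] assms by (simp add: add_divide_distrib)
  qed
  have "slow b (s + t) - (real m + s / breakpoint b m) \<le> slow b t" for m
    by (rule slow_greatest) (use *[of m] in \<open>simp add: algebra_simps\<close>)
  then have "slow b (s + t) - slow b t \<le> slow b s"
    by (intro slow_greatest) (simp add: algebra_simps)
  then show ?thesis by simp
qed

text \<open>On the unit interval the term of index 0 is least, since all others are at least 1. This
  makes small balls the same as for the usual metric.\<close>

lemma slow_eq_arg:
  assumes "0 \<le> t" "t \<le> 1"
  shows "slow b t = t"
proof (rule antisym)
  show "t \<le> slow b t"
  proof (rule slow_greatest)
    fix n show "t \<le> real n + t / breakpoint b n"
    proof (cases n)
      case (Suc m)
      then show ?thesis using assms breakpoint_pos[of n] by (simp add: add_increasing2 del: breakpoint.simps)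
    qed simp
  qed
qed (rule slow_le_arg[OF assms(1)])

lemma slow_less_iff:
  assumes "0 \<le> t" "e \<le> 1"
  shows "slow b t < e \<longleftrightarrow> t < e"
proof (cases "t \<le> 1")
  case True
  then show ?thesis using slow_eq_arg assms by simp
next
  case False
  then have "1 \<le> slow b t" using slow_mono[of 1 t] slow_eq_arg[of 1] by simp
  then show ?thesis using False assms(2) by linarith
qed

abbreviation line_metric :: "real \<Rightarrow> real \<Rightarrow> real" where
  "line_metric s t \<equiv> slow b \<bar>s - t\<bar>"

lemma slow_eq_0_iff: "0 \<le> t \<Longrightarrow> slow b t = 0 \<longleftrightarrow> t = 0"
  using slow_eq_arg[of t] slow_eq_arg[of 1] slow_mono[of 1 t] by (cases "t \<le> 1") auto

lemma Metric_space_line: "Metric_space UNIV line_metric"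
proof
  show "0 \<le> line_metric s t" for s t by (rule slow_nonneg) simp
  show "line_metric s t = line_metric t s" for s t by (simp add: abs_minus_commute)
  show "line_metric s t = 0 \<longleftrightarrow> s = t" for s t using slow_eq_0_iff[of "\<bar>s - t\<bar>"] by simp
  show "line_metric s u \<le> line_metric s t + line_metric t u" for s t u
  proof -
    have "line_metric s u \<le> slow b (\<bar>s - t\<bar> + \<bar>t - u\<bar>)" by (rule slow_mono) auto
    also have "\<dots> \<le> line_metric s t + line_metric t u" by (rule slow_subadditive) auto
    finally show ?thesis .
  qed
qed

lemma line_coarsely_equivalent: "coarsely_equivalent UNIV line_metric (\<lambda>s t. \<bar>s - t\<bar>)"
  unfolding coarsely_equivalent_def
\<comment> \<open>The usual distance is bounded by the slow distance \<open>u\<close>: beyond the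
  breakpoint of index \<open>\<lfloor>u\<rfloor> + 1\<close> the slow distance would exceed
  \<open>u\<close>.\<close>
proof (rule exI[of _ "\<lambda>u. u"], rule exI[of _ "\<lambda>u. breakpoint b (Suc (nat \<lfloor>u\<rfloor>))"], intro conjI ballI)
  show "\<not> bdd_above ((\<lambda>u. u) ` {0..} :: real set)"
  proof
    assume "bdd_above ((\<lambda>u. u) ` {0..} :: real set)"
    then obtain K :: real where K: "\<And>u. 0 \<le> u \<Longrightarrow> u \<le> K" by (auto simp: bdd_above_def)
    show False using K[of "\<bar>K\<bar> + 1"] by linarith
  qed
  show "mono_on {0..} (\<lambda>u :: real. breakpoint b (Suc (nat \<lfloor>u\<rfloor>)))"
    by (intro mono_onI breakpoint_mono) (simp add: floor_mono nat_mono)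
  have unbounded: "\<not> bdd_above (g ` {0..})" if g: "\<And>u. real (Suc (nat \<lfloor>u\<rfloor>)) \<le> g u" for g :: "real \<Rightarrow> real"
  proof
    assume "bdd_above (g ` {0..})"
    then obtain K where K: "\<And>u. 0 \<le> u \<Longrightarrow> g u \<le> K" by (auto simp: bdd_above_def)
    show False using K[of "\<bar>K\<bar>"] g[of "\<bar>K\<bar>"] by linarith
  qed
  show "\<not> bdd_above ((\<lambda>u :: real. breakpoint b (Suc (nat \<lfloor>u\<rfloor>))) ` {0..})"
    by (rule unbounded) (rule breakpoint_ge_index)
  show "(\<lambda>u :: real. breakpoint b (Suc (nat \<lfloor>u\<rfloor>))) \<in> {0..} \<rightarrow> {0..}"
    using breakpoint_pos by (auto intro: less_imp_le simp del: breakpoint.simps)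
  fix s t :: real
  show "line_metric s t \<le> \<bar>s - t\<bar>" by (rule slow_le_arg) simp
  show "\<bar>s - t\<bar> \<le> breakpoint b (Suc (nat \<lfloor>line_metric s t\<rfloor>))"
  proof (rule ccontr)
    assume "\<not> ?thesis"
    then have "real (Suc (nat \<lfloor>line_metric s t\<rfloor>)) \<le> line_metric s t"
      by (intro slow_ge_of_ge_breakpoint) simp
    moreover have "0 \<le> line_metric s t" by (rule slow_nonneg) simp
    ultimately show False by linarith
  qed
qed (auto simp: mono_on_def)

lemma line_topologically_equivalent: "topologically_equivalent UNIV line_metric (\<lambda>s t. \<bar>s - t\<bar>)"
proof -
  interpret R: Metric_space UNIV line_metric by (rule Metric_space_line)
  interpret S: Metric_space "UNIV :: real set" "\<lambda>s t. \<bar>s - t\<bar>" by unfold_locales auto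
  have b1: "R.mball x e = S.mball x e" if "e \<le> 1" for x e
    using slow_less_iff that by (auto simp: R.mball_def S.mball_def)
  have "openin R.mtopology U \<longleftrightarrow> openin S.mtopology U" for U
  proof -
    have "(\<exists>e>0. R.mball x e \<subseteq> U) \<longleftrightarrow> (\<exists>e>0. S.mball x e \<subseteq> U)" for x
    proof
      assume "\<exists>e>0. R.mball x e \<subseteq> U"
      then obtain e where "0 < e" "R.mball x e \<subseteq> U" by blast
      then show "\<exists>e>0. S.mball x e \<subseteq> U"
        using b1[of "min e 1" x] R.mball_subset_concentric[of "min e 1" e x] by (intro exI[of _ "min e 1"]) auto
    next
      assume "\<exists>e>0. S.mball x e \<subseteq> U"
      then obtain e where "0 < e" "S.mball x e \<subseteq> U" by blast
      then show "\<exists>e>0. R.mball x e \<subseteq> U"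
        using b1[of "min e 1" x] S.mball_subset_concentric[of "min e 1" e x] by (intro exI[of _ "min e 1"]) auto
    qed
    then show ?thesis by (simp add: R.openin_mtopology S.openin_mtopology)
  qed
  then show ?thesis unfolding topologically_equivalent_def by (simp add: topology_eq)
qed

lemma floor_breakpoint_close:
  assumes "line_metric s t < real n"
  shows "\<bar>\<lfloor>s / breakpoint b n\<rfloor> - \<lfloor>t / breakpoint b n\<rfloor>\<bar> \<le> 1"
proof -
  have "\<bar>s - t\<bar> < breakpoint b n" using slow_ge_of_ge_breakpoint[of n "\<bar>s - t\<bar>"] assms by linarith
  then have "\<bar>s / breakpoint b n - t / breakpoint b n\<bar> < 1"
    using breakpoint_pos[of n] by (simp add: diff_divide_distrib[symmetric] abs_divide)
  then show ?thesis by linarith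
qed

lemma floor_breakpoint_far:
  assumes "\<bar>\<lfloor>s / breakpoint b n\<rfloor> - \<lfloor>t / breakpoint b n\<rfloor>\<bar> \<le> m"
  shows "\<bar>s - t\<bar> \<le> (real_of_int m + 1) * breakpoint b n"
proof -
  have "\<bar>s / breakpoint b n - t / breakpoint b n\<bar> \<le> real_of_int m + 1" using assms by linarith
  then show ?thesis
    using breakpoint_pos[of n] by (simp add: diff_divide_distrib[symmetric] abs_divide pos_divide_le_eq)
qed

text \<open>Blocks of length \<open>breakpoint b n\<close>, where \<open>n\<close> is
  \<open>r\<close> rounded up, alternate between two colours and have slow diameter at most
  \<open>n + 1\<close>. With one colour, half steps would chain 0 to points arbitrarily far
  away.\<close>

lemma asdim_AN_line: "asdim_AN UNIV line_metric = 1"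
proof -
  have "asdim_AN_le UNIV line_metric 1"
  proof (rule asdim_AN_leI[where A = 1 and B = 2])
    fix r :: real assume r: "0 \<le> r"
    define n where "n = nat \<lceil>r\<rceil>"
    have n: "r \<le> real n" "real n < r + 1" using r unfolding n_def by linarith+
    define m where "m s = \<lfloor>s / breakpoint b n\<rfloor>" for s
    show "\<exists>(F :: real \<Rightarrow> int) (c :: real \<Rightarrow> nat). \<forall>x\<in>UNIV. c x \<le> 1 \<and> (\<forall>y\<in>UNIV.
       (line_metric x y < r \<and> c x = c y \<longrightarrow> F x = F y) \<and> (F x = F y \<longrightarrow> line_metric x y \<le> 1 * r + 2))"
    proof (intro exI[of _ m] exI[of _ "\<lambda>s. nat (m s mod 2)"] ballI conjI impI)
      fix x y
      show "nat (m x mod 2) \<le> 1" by simp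
      show "m x = m y" if "line_metric x y < r \<and> nat (m x mod 2) = nat (m y mod 2)"
      proof -
        have "\<bar>m x - m y\<bar> \<le> 1" unfolding m_def by (rule floor_breakpoint_close) (use that n in simp)
        moreover have "m x mod 2 = m y mod 2"
          using that eq_nat_nat_iff[of "m x mod 2" "m y mod 2"] by simp
        ultimately show ?thesis by presburger
      qed
      show "line_metric x y \<le> 1 * r + 2" if "m x = m y"
      proof -
        have "\<bar>x - y\<bar> \<le> (real_of_int 0 + 1) * breakpoint b n"
          by (rule floor_breakpoint_far) (use that in \<open>simp add: m_def\<close>)
        then have "line_metric x y \<le> real n + 1" by (intro slow_le_of_le_breakpoint) auto
        then show ?thesis using n by simp
      qed
    qed
  qed simp
  moreover have "\<not> asdim_AN_le UNIV line_metric 0"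
  proof
    assume "asdim_AN_le UNIV line_metric 0"
    then obtain A B where "\<And>r. 0 \<le> r \<Longrightarrow> \<exists>(F :: real \<Rightarrow> real set) (c :: real \<Rightarrow> nat). \<forall>x\<in>UNIV. c x \<le> 0 \<and>
      (\<forall>y\<in>UNIV. (line_metric x y < r \<and> c x = c y \<longrightarrow> F x = F y) \<and>
        (F x = F y \<longrightarrow> line_metric x y \<le> A * r + B))"
      by (rule asdim_AN_leD) blast
    from this[OF zero_le_one] obtain F :: "real \<Rightarrow> real set" and c :: "real \<Rightarrow> nat" where
      Fc: "\<forall>x\<in>UNIV. c x \<le> 0 \<and> (\<forall>y\<in>UNIV. (line_metric x y < 1 \<and> c x = c y \<longrightarrow> F x = F y) \<and>
        (F x = F y \<longrightarrow> line_metric x y \<le> A * 1 + B))" by blast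
    have F: "F x = F y" if "line_metric x y < 1" for x y
      using Fc that by (metis UNIV_I le_zero_eq)
    have b: "line_metric x y \<le> A + B" if "F x = F y" for x y
      using Fc that by simp
    have "F (real j / 2) = F 0" for j
    proof (induction j)
      case (Suc j)
      have "line_metric (real (Suc j) / 2) (real j / 2) < 1"
        using slow_eq_arg[of "1/2"] by (simp add: diff_divide_distrib[symmetric])
      then show ?case using F Suc by metis
    qed simp
    then have bnd: "line_metric (real j / 2) 0 \<le> A + B" for j by (rule b)
    obtain n where n: "A + B < real n" using reals_Archimedean2 by blast
    obtain j where "2 * breakpoint b n < real j" using reals_Archimedean2 by blast
    then have "real n \<le> line_metric (real j / 2) 0" by (intro slow_ge_of_ge_breakpoint) simp
    then show False using bnd[of j] n by linarith
  qed
  ultimately have "asdim_AN UNIV line_metric = enat (Suc 0)" by (intro asdim_AN_eqI) simp_all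
  then show ?thesis by (simp add: one_enat_def)
qed

end

section \<open>The space\<close>

text \<open>The height of the \<open>k\<close>-th tower is quadratic in \<open>k\<close>, so that it
  outgrows every affine bound at scale \<open>k\<close>. The carrier is abstract and is coded by
  real numbers at the end.\<close>

locale tower_sum =
  fixes T :: "nat \<Rightarrow> nat set" and E :: "nat \<Rightarrow> nat \<Rightarrow> nat \<Rightarrow> nat \<Rightarrow> bool" and \<pi> s :: "nat \<Rightarrow> nat \<Rightarrow> nat"
    and C :: "'p set" and lev pt :: "'p \<Rightarrow> nat"
  assumes tower: "\<And>k. tower (k * k) {..6} wheel 1 (T k) (E k) (\<pi> k) (s k)"
    and pt: "\<And>a. a \<in> C \<Longrightarrow> pt a \<in> T (lev a)"
    and surj: "\<And>k x. x \<in> T k \<Longrightarrow> \<exists>a\<in>C. lev a = k \<and> pt a = x"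
    and inj: "\<And>a b. a \<in> C \<Longrightarrow> b \<in> C \<Longrightarrow> lev a = lev b \<Longrightarrow> pt a = pt b \<Longrightarrow> a = b"
begin

text \<open>Above the top floor everything is linked, so \<open>stage\<close> is at most
  \<open>k * k + 1\<close>.\<close>

definition linked :: "nat \<Rightarrow> nat \<Rightarrow> nat \<Rightarrow> nat \<Rightarrow> bool" where
  "linked k i x y \<longleftrightarrow> (i \<le> k * k \<longrightarrow> E k i x y)"

definition stage :: "nat \<Rightarrow> nat \<Rightarrow> nat \<Rightarrow> nat" where
  "stage k x y = (LEAST i. linked k i x y)"

text \<open>This exceeds all distances within the tower, which are at most
  \<open>k + 1 + (k * k + 1)\<close>.\<close>

definition width :: "nat \<Rightarrow> nat" where
  "width k = k * k + k + 3"

text \<open>The distance is logarithmic: it grows by \<open>1\<close> when the scale goes up one floor of the tower,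
  which is why a composition of two relations on a floor only needs to lie in the next floor.\<close>

definition dist_nat :: "'p \<Rightarrow> 'p \<Rightarrow> nat" where
  "dist_nat a b =
     (if a = b then 0 else if lev a = lev b then lev a + 1 + stage (lev a) (pt a) (pt b)
      else max (width (lev a)) (width (lev b)))"

definition d :: "'p \<Rightarrow> 'p \<Rightarrow> real" where
  "d a b = (if a \<in> C \<and> b \<in> C then real (dist_nat a b) else 0)"

lemma finite_T: "finite (T k)"
  using tower[of k] by (auto simp: tower_def graph_on_def)

lemma linked_refl: "x \<in> T k \<Longrightarrow> linked k i x x"
  using tower[of k] by (auto simp: tower_def graph_on_def linked_def)

lemma linked_sym: "x \<in> T k \<Longrightarrow> y \<in> T k \<Longrightarrow> linked k i x y \<Longrightarrow> linked k i y x"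
  using tower[of k] unfolding tower_def graph_on_def linked_def by blast

lemma linked_trans:
  assumes "x \<in> T k" "y \<in> T k" "z \<in> T k" "linked k i x y" "linked k i y z"
  shows "linked k (Suc i) x z"
proof -
  have *: "\<forall>i<k * k. \<forall>x\<in>T k. \<forall>y\<in>T k. \<forall>z\<in>T k. E k i x y \<and> E k i y z \<longrightarrow> E k (Suc i) x z"
    using tower[of k] unfolding tower_def by blast
  show ?thesis unfolding linked_def
  proof
    assume "Suc i \<le> k * k"
    then show "E k (Suc i) x z" using * assms unfolding linked_def by (meson Suc_le_lessD Suc_leD)
  qed
qed

lemma linked_mono:
  assumes "x \<in> T k" "y \<in> T k" "linked k i x y" "i \<le> j"
  shows "linked k j x y"
  using assms(4,3)
proof (induction rule: dec_induct)
  case (step j)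
  then show ?case using linked_trans[of x k y y j] linked_refl assms by blast
qed

lemma stage_le_iff:
  assumes "x \<in> T k" "y \<in> T k"
  shows "stage k x y \<le> i \<longleftrightarrow> linked k i x y"
proof
  have "linked k (Suc (k * k)) x y" by (simp add: linked_def)
  then have "linked k (stage k x y) x y" unfolding stage_def by (rule LeastI)
  then show "stage k x y \<le> i \<Longrightarrow> linked k i x y" using linked_mono assms by blast
  show "linked k i x y \<Longrightarrow> stage k x y \<le> i" unfolding stage_def by (rule Least_le)
qed

lemma stage_le: "x \<in> T k \<Longrightarrow> y \<in> T k \<Longrightarrow> stage k x y \<le> Suc (k * k)"
  by (simp add: stage_le_iff linked_def)

lemma stage_sym: "x \<in> T k \<Longrightarrow> y \<in> T k \<Longrightarrow> stage k x y = stage k y x"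
  unfolding stage_def using linked_sym by metis

lemma stage_triangle:
  assumes "x \<in> T k" "y \<in> T k" "z \<in> T k"
  shows "stage k x z \<le> Suc (max (stage k x y) (stage k y z))"
proof -
  let ?m = "max (stage k x y) (stage k y z)"
  have "linked k ?m x y" "linked k ?m y z"
    using stage_le_iff[OF assms(1,2), of ?m] stage_le_iff[OF assms(2,3), of ?m] by simp_all
  then show ?thesis using linked_trans[OF assms] stage_le_iff[OF assms(1,3)] by blast
qed

lemma dist_nat_sym: "a \<in> C \<Longrightarrow> b \<in> C \<Longrightarrow> dist_nat a b = dist_nat b a"
  unfolding dist_nat_def using stage_sym[of "pt a" "lev a" "pt b"] pt[of a] pt[of b] by auto

lemma dist_nat_le_width:
  assumes "a \<in> C" "b \<in> C" "lev a = lev b"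
  shows "dist_nat a b \<le> width (lev a)"
  unfolding dist_nat_def using stage_le[of "pt a" "lev a" "pt b"] pt[of a] pt[of b] assms
  by (auto simp: width_def)

lemma dist_nat_ge: "a \<noteq> b \<Longrightarrow> lev a < dist_nat a b \<and> lev b < dist_nat a b"
  by (auto simp: dist_nat_def width_def max_def)

lemma dist_nat_cross: "lev a \<noteq> lev b \<Longrightarrow> dist_nat a b = max (width (lev a)) (width (lev b))"
  by (auto simp: dist_nat_def)

text \<open>Within a tower a composition costs one floor, which is paid for by the summand
  \<open>lev a + 1\<close> occurring twice on the right. A detour through another tower is at least
  as long as the width of the given one.\<close>

lemma dist_nat_triangle:
  assumes C: "a \<in> C" "b \<in> C" "c \<in> C"
  shows "dist_nat a c \<le> dist_nat a b + dist_nat b c"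
proof (cases "a = b \<or> b = c \<or> a = c")
  case True
  then show ?thesis by (auto simp: dist_nat_def)
next
  case False
  consider "lev a = lev b" "lev b = lev c" | "lev a = lev c" "lev b \<noteq> lev a" | "lev a \<noteq> lev c"
    by metis
  then show ?thesis
  proof cases
    case 1
    then show ?thesis
      using stage_triangle[of "pt a" "lev a" "pt b" "pt c"] pt[OF C(1)] pt[OF C(2)] pt[OF C(3)] False
      unfolding dist_nat_def by auto
  next
    case 2
    then show ?thesis using dist_nat_le_width[OF C(1,3)] dist_nat_cross[of a b] by simp
  next
    case 3
    then show ?thesis using dist_nat_cross[of a c] dist_nat_cross[of a b] dist_nat_cross[of b c]
      by (cases "lev a = lev b"; cases "lev b = lev c") auto
  qed
qed

lemma Metric_space_d: "Metric_space C d"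
proof
  show "0 \<le> d a b" for a b by (simp add: d_def)
  show "d a b = d b a" for a b using dist_nat_sym by (auto simp: d_def)
  show "d a b = 0 \<longleftrightarrow> a = b" if "a \<in> C" "b \<in> C" for a b
    using that dist_nat_ge[of a b] by (auto simp: d_def dist_nat_def)
  show "d a c \<le> d a b + d b c" if "a \<in> C" "b \<in> C" "c \<in> C" for a b c
    using that dist_nat_triangle[OF that] unfolding d_def by (simp flip: of_nat_add)
qed

lemma finite_low: "finite {a \<in> C. lev a < n}"
proof -
  have "inj_on (\<lambda>a. (lev a, pt a)) {a \<in> C. lev a < n}" using inj by (auto intro: inj_onI)
  moreover have "(\<lambda>a. (lev a, pt a)) ` {a \<in> C. lev a < n} \<subseteq> Sigma {..<n} T" using pt by auto
  moreover have "finite (Sigma {..<n} T)" using finite_T by auto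
  ultimately show ?thesis by (meson finite_imageD finite_subset)
qed

text \<open>Distances exceed levels, so apart from its centre a ball contains only points of low
  level. These are finitely many, and their number does not depend on the centre, whence properness
  and bounded geometry.\<close>

lemma d_ball:
  assumes "a \<in> C" "b \<in> C" "d a b \<le> r" "a \<noteq> b"
  shows "b \<in> {b \<in> C. lev b < nat \<lceil>r\<rceil>}"
proof -
  have "real (lev b) < r" using dist_nat_ge[OF assms(4)] assms unfolding d_def by simp
  then show ?thesis using assms(2) by (simp, linarith)
qed

lemma proper_metric_d: "proper_metric C d"
  unfolding proper_metric_def
proof (intro ballI allI)
  interpret Metric_space C d by (rule Metric_space_d)
  fix a r assume a: "a \<in> C"
  have "mcball a r \<subseteq> insert a {b \<in> C. lev b < nat \<lceil>r\<rceil>}"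
    using d_ball[OF a] by (auto simp: mcball_def)
  then have "finite (mcball a r)" using finite_low finite_subset by blast
  then show "compactin mtopology (mcball a r)"
    by (intro finite_imp_compactin) auto
qed

lemma bounded_geometry_d: "bounded_geometry C d"
  unfolding bounded_geometry_def
proof (intro exI[of _ "1::real"] conjI allI impI)
  interpret Metric_space C d by (rule Metric_space_d)
  fix r :: real
  let ?L = "{b \<in> C. lev b < nat \<lceil>r\<rceil>}"
  show "\<exists>N. \<forall>a\<in>C. \<forall>S\<subseteq>mball a r. (\<forall>x\<in>S. \<forall>y\<in>S. x \<noteq> y \<longrightarrow> 1 \<le> d x y) \<longrightarrow> finite S \<and> card S \<le> N"
  proof (intro exI[of _ "Suc (card ?L)"] ballI allI impI)
    fix a S assume a: "a \<in> C" and S: "S \<subseteq> mball a r"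
    have "S \<subseteq> insert a ?L"
    proof
      fix b assume "b \<in> S"
      then have "b \<in> C" "d a b \<le> r" using S by (auto simp: mball_def)
      then show "b \<in> insert a ?L" using d_ball[OF a] by blast
    qed
    moreover have fin: "finite (insert a ?L)" using finite_low by simp
    ultimately have "finite S" "card S \<le> card (insert a ?L)"
      using finite_subset card_mono by blast+
    moreover have "card (insert a ?L) \<le> Suc (card ?L)" using finite_low by (simp add: card_insert_if)
    ultimately show "finite S \<and> card S \<le> Suc (card ?L)" by linarith
  qed
qed simp

text \<open>At scale \<open>k + 2\<close> points linked on floor 0 count as close, being at distance
  at most \<open>k + 1\<close>, and pieces of small diameter are linked on the top floor. So the
  cover would be one excluded by \<open>tower_not_two_colourable\<close>.\<close>

lemma not_asdim_AN_le_1: "\<not> asdim_AN_le C d 1"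
proof
  assume "asdim_AN_le C d 1"
  then obtain A B where cov: "\<And>r. 0 \<le> r \<Longrightarrow> \<exists>(F :: 'p \<Rightarrow> 'p set) (c :: 'p \<Rightarrow> nat). \<forall>x\<in>C. c x \<le> 1 \<and>
      (\<forall>y\<in>C. (d x y < r \<and> c x = c y \<longrightarrow> F x = F y) \<and> (F x = F y \<longrightarrow> d x y \<le> A * r + B))"
    by (rule asdim_AN_leD) blast
  \<comment> \<open>For such \<open>k\<close> the affine bound at scale \<open>k + 2\<close> is less
    than \<open>k * k + k + 2\<close>, the distance of points that are not linked even on the top
    floor.\<close>
  obtain k :: nat where k: "3 * \<bar>A\<bar> + \<bar>B\<bar> + 1 < real k" using reals_Archimedean2 by blast
  have "A * (real k + 2) \<le> \<bar>A\<bar> * (real k + 2)" by (rule mult_right_mono) auto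
  moreover have "(3 * \<bar>A\<bar> + \<bar>B\<bar> + 1) * real k \<le> real k * real k" using k by (intro mult_right_mono) auto
  moreover have "\<bar>A\<bar> * 1 \<le> \<bar>A\<bar> * real k" "\<bar>B\<bar> * 1 \<le> \<bar>B\<bar> * real k"
    using k by (intro mult_left_mono; linarith)+
  ultimately have AB: "A * real (k + 2) + B < real (k * k + k + 2)"
    using abs_ge_self[of B] by (simp add: algebra_simps)
  have "0 \<le> real (k + 2)" by simp
  from cov[OF this] obtain F :: "'p \<Rightarrow> 'p set" and c :: "'p \<Rightarrow> nat" where Fc: "\<forall>x\<in>C. c x \<le> 1 \<and>
      (\<forall>y\<in>C. (d x y < real (k + 2) \<and> c x = c y \<longrightarrow> F x = F y) \<and>
        (F x = F y \<longrightarrow> d x y \<le> A * real (k + 2) + B))" by blast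
  have "\<forall>x\<in>T k. \<exists>a. a \<in> C \<and> lev a = k \<and> pt a = x" using surj by blast
  then obtain q where q: "\<And>x. x \<in> T k \<Longrightarrow> q x \<in> C \<and> lev (q x) = k \<and> pt (q x) = x" by metis
  have dq: "dist_nat (q x) (q y) = (if x = y then 0 else k + 1 + stage k x y)" if "x \<in> T k" "y \<in> T k" for x y
  proof (cases "x = y")
    case False
    then have "q x \<noteq> q y" using q[OF that(1)] q[OF that(2)] by metis
    then show ?thesis using False q[OF that(1)] q[OF that(2)] by (simp add: dist_nat_def)
  qed (simp add: dist_nat_def)
  show False
  proof (rule tower_not_two_colourable[OF tower[of k], where c = "\<lambda>x. c (q x)" and U = "\<lambda>x. F (q x)"])
    show "c (q x) < 2" if "x \<in> T k" for x using Fc q[OF that] by fastforce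
    show "F (q x) = F (q y)" if "x \<in> T k" "y \<in> T k" "E k 0 x y" "c (q x) = c (q y)" for x y
    proof -
      have "stage k x y \<le> 0" using that stage_le_iff[OF that(1,2), of 0] by (simp add: linked_def)
      then have "d (q x) (q y) < real (k + 2)" using dq[OF that(1,2)] q that(1,2) by (simp add: d_def)
      then show ?thesis using Fc q that by blast
    qed
    show "E k (k * k) x y" if "x \<in> T k" "y \<in> T k" "F (q x) = F (q y)" for x y
    proof -
      have "d (q x) (q y) \<le> A * real (k + 2) + B" using Fc q that by blast
      then have "real (dist_nat (q x) (q y)) < real (k * k + k + 2)" using AB q that(1,2) by (simp add: d_def)
      then have "dist_nat (q x) (q y) < k * k + k + 2" by (simp only: of_nat_less_iff)
      then have "x = y \<or> stage k x y \<le> k * k" unfolding dq[OF that(1,2)] by (auto split: if_splits)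
      then have "linked k (k * k) x y" using stage_le_iff[OF that(1,2)] linked_refl that(1) by auto
      then show ?thesis by (simp add: linked_def)
    qed
  qed
qed

end

section \<open>The stretched line and the upper bound for the product\<close>

locale coloured_tower_sum = tower_sum T E \<pi> s C lev pt
  for T E \<pi> s and C :: "'p set" and lev pt +
  fixes Mc :: "nat \<Rightarrow> nat \<Rightarrow> int" and Fc :: "nat \<Rightarrow> nat \<Rightarrow> nat \<Rightarrow> int \<Rightarrow> nat set \<times> nat \<times> int"
    and cc :: "nat \<Rightarrow> nat \<Rightarrow> nat \<Rightarrow> int \<Rightarrow> nat"
  assumes col: "\<And>k i. i < k * k \<Longrightarrow> colouring (T k) (E k i) (E k (Suc i)) (Mc k i) (Fc k i) (cc k i)"
begin

text \<open>At scale \<open>n\<close> tower \<open>k\<close> is seen at floor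
  \<open>n - k - 1\<close>. Summing the durations on these floors makes the next breakpoint at least
  \<open>M + 1\<close> blocks of length \<open>breakpoint growth n\<close>, for each of the
  durations \<open>M\<close>.\<close>

definition growth :: "nat \<Rightarrow> real" where
  "growth n = (\<Sum>k<n. \<bar>real_of_int (Mc k (n - k - 1))\<bar>)"

sublocale breakpoints growth
  by unfold_locales (simp add: growth_def sum_nonneg)

lemma breakpoint_dominates:
  assumes "k < n"
  shows "(real_of_int (Mc k (n - k - 1)) + 1) * breakpoint growth n \<le> breakpoint growth (Suc n)"
proof -
  have "\<bar>real_of_int (Mc k (n - k - 1))\<bar> \<le> growth n"
    unfolding growth_def using assms by (intro member_le_sum) auto
  then have "real_of_int (Mc k (n - k - 1)) + 1 \<le> real n + 1 + growth n" by linarith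
  then show ?thesis using breakpoint_pos[of n] by (simp add: mult.commute mult_left_mono)
qed

abbreviation product_metric :: "'p \<times> real \<Rightarrow> 'p \<times> real \<Rightarrow> real" where
  "product_metric \<equiv> max_metric d line_metric"

text \<open>At scale \<open>n\<close> the tower number \<open>k\<close> looks like a discrete space if \<open>n \<le> k\<close>, like a point if
  \<open>k\<^sup>2 + k < n\<close>, and like its floor number \<open>n - k - 1\<close> otherwise.\<close>

lemma asdim_AN_le_product: "asdim_AN_le (C \<times> UNIV) product_metric 2"
proof (rule asdim_AN_leI[where A = 1 and B = 3])
  fix r :: real assume r: "0 \<le> r"
  define n where "n = nat \<lceil>r\<rceil>"
  have n: "r \<le> real n" "real n < r + 1" using r unfolding n_def by linarith+
  \<comment> \<open>The integer time of the colourings counts blocks of this length.\<close>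
  define m where "m t = \<lfloor>t / breakpoint growth n\<rfloor>" for t
  \<comment> \<open>The first component keeps the three regimes apart, and in the last regime also
    the towers.\<close>
  define F :: "'p \<times> real \<Rightarrow> nat \<times> 'p set \<times> nat set \<times> nat \<times> int" where
    "F = (\<lambda>(a, t). if n \<le> lev a then (0, {a}, {}, 0, m t)
       else if lev a * lev a + lev a < n then (1, {}, {}, 0, m t)
       else (lev a + 2, {}, Fc (lev a) (n - lev a - 1) (pt a) (m t)))"
  define c :: "'p \<times> real \<Rightarrow> nat" where
    "c = (\<lambda>(a, t). if n \<le> lev a \<or> lev a * lev a + lev a < n then nat (m t mod 2)
       else cc (lev a) (n - lev a - 1) (pt a) (m t))"
  have same_block: "m s = m t" if "\<bar>m s - m t\<bar> \<le> 1" "nat (m s mod 2) = nat (m t mod 2)" for s t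
  proof -
    have "m s mod 2 = m t mod 2" using that(2) eq_nat_nat_iff[of "m s mod 2" "m t mod 2"] by simp
    then show ?thesis using that(1) by presburger
  qed
  \<comment> \<open>The \<open>M + 1\<close> blocks fit below the next breakpoint, so the slow
    distance is at most \<open>n + 2\<close>, and \<open>n < r + 1\<close>.\<close>
  have line_le: "line_metric s t \<le> r + 3"
    if "\<bar>m s - m t\<bar> \<le> M" "(real_of_int M + 1) * breakpoint growth n \<le> breakpoint growth (Suc n)" for s t M
  proof -
    have "\<bar>s - t\<bar> \<le> (real_of_int M + 1) * breakpoint growth n" by (rule floor_breakpoint_far) (use that in \<open>simp add: m_def\<close>)
    then have "line_metric s t \<le> real (Suc n) + 1" using that by (intro slow_le_of_le_breakpoint) auto
    then show ?thesis using n by simp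
  qed
  have line_le_0: "line_metric s t \<le> r + 3" if "m s = m t" for s t
    by (rule line_le[of s t 0]) (use that breakpoint_mono[of n "Suc n"] in simp_all)
  have active: "n - lev a - 1 < lev a * lev a" if "\<not> n \<le> lev a" "\<not> lev a * lev a + lev a < n" for a
    using that by linarith
  show "\<exists>(F :: 'p \<times> real \<Rightarrow> nat \<times> 'p set \<times> nat set \<times> nat \<times> int) (c :: 'p \<times> real \<Rightarrow> nat).
     \<forall>x\<in>C \<times> UNIV. c x \<le> 2 \<and> (\<forall>y\<in>C \<times> UNIV. (product_metric x y < r \<and> c x = c y \<longrightarrow> F x = F y) \<and>
       (F x = F y \<longrightarrow> product_metric x y \<le> 1 * r + 3))"
  proof (intro exI[of _ F] exI[of _ c] ballI conjI impI)
    fix x assume "x \<in> C \<times> (UNIV :: real set)"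
    then obtain a s where x: "x = (a, s)" "a \<in> C" by auto
    show "c x \<le> 2"
    proof (cases "n \<le> lev a \<or> lev a * lev a + lev a < n")
      case True
      have "nat (m s mod 2) \<le> 2" by simp
      then show ?thesis using True by (simp add: c_def x)
    next
      case False
      then have "cc (lev a) (n - lev a - 1) (pt a) (m s) < 3"
        using col[OF active[of a]] pt[OF x(2)] unfolding colouring_def by blast
      then show ?thesis using False by (simp add: c_def x)
    qed
    fix y assume "y \<in> C \<times> (UNIV :: real set)"
    then obtain e t where y: "y = (e, t)" "e \<in> C" by auto
    have dxy: "product_metric x y = max (real (dist_nat a e)) (line_metric s t)"
      by (simp add: x y max_metric_def d_def)
    show "F x = F y" if close: "product_metric x y < r \<and> c x = c y"
    proof -
      have dn: "dist_nat a e < n" and ln: "line_metric s t < real n" using close n unfolding dxy by auto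
      have ms: "\<bar>m s - m t\<bar> \<le> 1" unfolding m_def by (rule floor_breakpoint_close[OF ln])
      consider "n \<le> lev a" | "lev a * lev a + lev a < n" | "\<not> n \<le> lev a" "\<not> lev a * lev a + lev a < n"
        by blast
      then show ?thesis
      proof cases
        case 1
        then have "a = e" using dist_nat_ge[of a e] dn by auto
        then show ?thesis using 1 same_block[OF ms] close by (simp add: F_def c_def x y)
      next
        case 2
        have "lev e * lev e + lev e < n"
        proof (cases "lev a = lev e")
          case False
          then have "width (lev e) < n" using dn dist_nat_cross[of a e] by simp
          then show ?thesis by (simp add: width_def)
        qed (use 2 in simp)
        moreover have "\<not> n \<le> lev a" "\<not> n \<le> lev e" using 2 calculation by linarith+
        ultimately show ?thesis using 2 same_block[OF ms] close by (simp add: F_def c_def x y)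
      next
        case 3
        have lev: "lev a = lev e"
        proof (rule ccontr)
          assume "lev a \<noteq> lev e"
          then have "width (lev a) < n" using dn dist_nat_cross[of a e] by simp
          then show False using 3 by (simp add: width_def)
        qed
        let ?k = "lev a" let ?i = "n - ?k - 1"
        have "linked ?k ?i (pt a) (pt e)"
        proof (cases "a = e")
          case False
          then have "stage ?k (pt a) (pt e) \<le> ?i" using dn lev by (simp add: dist_nat_def)
          then show ?thesis using stage_le_iff pt[OF x(2)] pt[OF y(2)] lev by simp
        qed (use linked_refl pt[OF x(2)] in simp)
        then have "E ?k ?i (pt a) (pt e)" using active[OF 3] by (simp add: linked_def)
        moreover have "cc ?k ?i (pt a) (m s) = cc ?k ?i (pt e) (m t)" using close 3 lev by (simp add: c_def x y)
        ultimately have "Fc ?k ?i (pt a) (m s) = Fc ?k ?i (pt e) (m t)"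
          using col[OF active[OF 3]] pt[OF x(2)] pt[OF y(2)] ms lev unfolding colouring_def by metis
        then show ?thesis using 3 lev by (simp add: F_def x y)
      qed
    qed
    show "product_metric x y \<le> 1 * r + 3" if eq: "F x = F y"
    proof -
      consider "n \<le> lev a" | "lev a * lev a + lev a < n" "\<not> n \<le> lev a"
        | "\<not> n \<le> lev a" "\<not> lev a * lev a + lev a < n"
        by blast
      then have "real (dist_nat a e) \<le> real n + 2 \<and> line_metric s t \<le> r + 3"
      proof cases
        case 1
        then have "a = e" "m s = m t" using eq by (auto simp: F_def x y split: if_splits)
        then show ?thesis using line_le_0 by (simp add: dist_nat_def)
      next
        case 2
        then have e: "lev e * lev e + lev e < n" "m s = m t" using eq by (auto simp: F_def x y split: if_splits)
        have "dist_nat a e \<le> n + 2"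
          using 2 e dist_nat_le_width[OF x(2) y(2)] dist_nat_cross[of a e]
          by (cases "lev a = lev e") (auto simp: width_def)
        then show ?thesis using line_le_0[OF e(2)] by simp
      next
        case 3
        let ?k = "lev a" let ?i = "n - ?k - 1"
        have lev: "lev e = ?k" and F: "Fc ?k ?i (pt a) (m s) = Fc ?k ?i (pt e) (m t)"
          using eq 3 by (auto simp: F_def x y split: if_splits)
        have p: "pt a \<in> T ?k" "pt e \<in> T ?k" using pt[OF x(2)] pt[OF y(2)] lev by simp_all
        obtain z where z: "z \<in> T ?k" "E ?k (Suc ?i) (pt a) z" "E ?k (Suc ?i) z (pt e)"
          and M: "\<bar>m s - m t\<bar> \<le> Mc ?k ?i"
          using col[OF active[OF 3]] p F unfolding colouring_def by meson
        \<comment> \<open>Two steps on floor \<open>?i + 1\<close> make one on floor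
          \<open>?i + 2\<close>, and \<open>?k + 1 + (?i + 2)\<close> equals
          \<open>n + 2\<close>.\<close>
        have "linked ?k (Suc (Suc ?i)) (pt a) (pt e)"
          by (rule linked_trans[OF p(1) z(1) p(2)]) (use z in \<open>simp_all add: linked_def\<close>)
        then have "stage ?k (pt a) (pt e) \<le> Suc (Suc ?i)" using stage_le_iff[OF p] by simp
        then have "dist_nat a e \<le> n + 2" using 3(1) lev
          by (simp add: dist_nat_def, intro impI, linarith)
        moreover have "line_metric s t \<le> r + 3"
          by (rule line_le[OF M breakpoint_dominates]) (use 3 in simp)
        ultimately show ?thesis by simp
      qed
      then show ?thesis using n unfolding dxy by simp
    qed
  qed
qed simp

lemma asdim_AN_eqs: "asdim_AN C d = 2" "asdim_AN (C \<times> UNIV) product_metric = 2"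
proof -
  have e: "asdim_AN_le C d m" if "asdim_AN_le (C \<times> UNIV) product_metric m" for m
  proof (rule asdim_AN_le_embedding[OF that order_refl, of C "\<lambda>a. (a, 0)"])
    show "product_metric (a, 0) (b, 0) = d a b" for a b
      using slow_eq_arg[of 0] by (simp add: max_metric_def d_def)
  qed simp
  have "asdim_AN C d = enat (Suc 1)"
    by (rule asdim_AN_eqI) (use e asdim_AN_le_product not_asdim_AN_le_1 in \<open>auto simp: numeral_2_eq_2\<close>)
  then show "asdim_AN C d = 2" by (simp add: numeral_eq_enat numeral_2_eq_2)
  have "asdim_AN (C \<times> UNIV) product_metric = enat (Suc 1)"
    by (rule asdim_AN_eqI) (use e asdim_AN_le_product not_asdim_AN_le_1 in \<open>auto simp: numeral_2_eq_2\<close>)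
  then show "asdim_AN (C \<times> UNIV) product_metric = 2" by (simp add: numeral_eq_enat numeral_2_eq_2)
qed

end

(* A proper metric space is separable, so it has at most continuum many points; hence
   it is no restriction to take the carrier of X to be a set of reals. The metric dX is
   arbitrary and unrelated to the usual one. *)
theorem mainTheorem3:
  "\<exists>(X :: real set) (dX :: real \<Rightarrow> real \<Rightarrow> real) (c :: real \<Rightarrow> real).
     Metric_space X dX \<and> X \<noteq> {} \<and> proper_metric X dX \<and> bounded_geometry X dX \<and>
     c \<in> {0..} \<rightarrow> {0..} \<and>
     (let dR = (\<lambda>s t :: real. c \<bar>s - t\<bar>) in
        Metric_space UNIV dR \<and>
        coarsely_equivalent UNIV dR (\<lambda>s t. \<bar>s - t\<bar>) \<and>
        topologically_equivalent UNIV dR (\<lambda>s t. \<bar>s - t\<bar>) \<and>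
        asdim_AN UNIV dR = 1 \<and>
        asdim_AN (X \<times> UNIV) (max_metric dX dR) = asdim_AN X dX \<and>
        asdim_AN X dX < asdim_AN X dX + asdim_AN UNIV dR)"
proof -
  have "\<forall>k. \<exists>T E \<pi> s. tower (k * k) {..6} wheel 1 T E \<pi> s"
    using ex_tower[OF graph_on_wheel, of 1] by simp
  then obtain T E \<pi> s where tower: "\<And>k. tower (k * k) {..6} wheel 1 (T k) (E k) (\<pi> k) (s k)"
    by metis
  have "\<forall>k i. \<exists>M (F :: nat \<Rightarrow> int \<Rightarrow> nat set \<times> nat \<times> int) c.
      i < k * k \<longrightarrow> colouring (T k) (E k i) (E k (Suc i)) M F c"
    using tower unfolding tower_def by blast
  then obtain Mc and Fc :: "nat \<Rightarrow> nat \<Rightarrow> nat \<Rightarrow> int \<Rightarrow> nat set \<times> nat \<times> int" and cc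
    where col: "\<And>k i. i < k * k \<Longrightarrow> colouring (T k) (E k i) (E k (Suc i)) (Mc k i) (Fc k i) (cc k i)"
    by metis
  \<comment> \<open>The disjoint union of the towers is coded by natural numbers, regarded as
    reals.\<close>
  define code where "code p = real (prod_encode p)" for p
  define lev where "lev a = fst (prod_decode (nat \<lfloor>a\<rfloor>))" for a :: real
  define pt where "pt a = snd (prod_decode (nat \<lfloor>a\<rfloor>))" for a :: real
  define C where "C = code ` Sigma UNIV T"
  have code: "lev (code p) = fst p" "pt (code p) = snd p" for p by (simp_all add: lev_def pt_def code_def)
  interpret coloured_tower_sum T E \<pi> s C lev pt Mc Fc cc
  proof
    show "\<exists>a\<in>C. lev a = k \<and> pt a = x" if "x \<in> T k" for k x
      using that code[of "(k, x)"] by (intro bexI[of _ "code (k, x)"]) (auto simp: C_def)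
  qed (use tower col code in \<open>auto simp: C_def prod_eq_iff\<close>)
  have "s 0 0 \<in> T 0"
    using tower[of 0] graph_refinesD(2) unfolding tower_def by (metis atMost_iff zero_le)
  then have "C \<noteq> {}" using surj by blast
  moreover have "slow growth \<in> {0..} \<rightarrow> {0..}" using slow_nonneg by auto
  moreover have "(2 :: enat) < 2 + 1" by (simp add: numeral_eq_enat one_enat_def)
  ultimately show ?thesis
    using Metric_space_d proper_metric_d bounded_geometry_d Metric_space_line line_coarsely_equivalent
      line_topologically_equivalent asdim_AN_line asdim_AN_eqs
    by (intro exI[of _ C] exI[of _ d] exI[of _ "slow growth"]) (simp add: Let_def)
qed

end
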